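(* Let $\Bbbk$ be an integral domain of characteristic $0$, $\ell\in\mathbb{Z}_+$, $\varepsilon^{1/2}$ a primitive $\ell$-th root of unity in the algebraic closure of the fraction field of $\Bbbk$, and $(M_\varepsilon,\tilde B)$ a root of unity quantum seed. Assume that $\ell$ is odd and coprime to the diagonal entries of the skew-symmetrizing matrix $D$. Then $$\mathbf{CU}(M_\varepsilon,\tilde B,\mathbf{inv})\cong\mathbf{U}(\tilde B,\mathbf{inv})_{\Bbbk}\quad\text{and}\quad \mathbf{CU}_\varepsilon(M_\varepsilon,\tilde B,\mathbf{inv})\cong\mathbf{U}(\tilde B,\mathbf{inv})_{\Bbbk[\varepsilon^{1/2}]}$$ (as $\Bbbk$-algebras and $\Bbbk[\varepsilon^{1/2}]$-algebras, respectively).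
   Context: Fix $N\in\mathbb{Z}_+$, a set $\mathbf{ex}\subseteq[1,N]$ of exchangeable indices and a set $\mathbf{inv}\subseteq[1,N]\setminus\mathbf{ex}$ (frozen indices to be inverted). An exchange matrix is $\tilde B=(b_{ij})\in M_{N\times\mathbf{ex}}(\mathbb{Z})$ whose $\mathbf{ex}\times\mathbf{ex}$ submatrix $B$ (principal part) is such that $DB$ is skew-symmetric for some $D=\mathrm{diag}(d_j,j\in\mathbf{ex})$, $d_j\in\mathbb{Z}_+$. For $k\in\mathbf{ex}$, $\mu_k(\tilde B)=(b'_{ij})$ with $b'_{ij}=-b_{ij}$ if $i=k$ or $j=k$, and $b'_{ij}=b_{ij}+\frac{|b_{ik}|b_{kj}+b_{ik}|b_{kj}|}{2}$ otherwise. **Classical upper cluster algebra.** For an integral domain $A$ of characteristic $0$, let $\mathcal{F}$ be a purely transcendental extension of degree $N$ of the fraction field of $A$. A seed is $(\tilde{\mathbf{x}},\tilde B)$ with $\tilde{\mathbf{x}}=\{x_1,\dots,x_N\}$ a transcendence basis of $\mathcal{F}$ (generating it) and $\tilde B$ an exchange matrix. Mutation at $k\in\mathbf{ex}$ replaces $\tilde B$ by $\mu_k(\tilde B)$ and $x_k$ by $x_k'$ with $x_kx_k'=\prod_{b_{ik}>0}x_i^{b_{ik}}+\prod_{b_{ik}<0}x_i^{-b_{ik}}$. Then $\mathbf{U}(\tilde B,\mathbf{inv})_A$ is the intersection, over all seeds $(\tilde{\mathbf{x}}'',\tilde B'')$ obtained from $(\tilde{\mathbf{x}},\tilde B)$ by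 sequences of mutations, of the rings $A[(x''_i)^{\pm1},x''_j;\ i\in\mathbf{ex}\sqcup\mathbf{inv},\ j\notin\mathbf{ex}\sqcup\mathbf{inv}]$. **Quantum setting.** $\mathcal{A}_\varepsilon^{1/2}:=\Bbbk[\varepsilon^{1/2}]$. For a skew-symmetric bicharacter $\Lambda:\mathbb{Z}^N\times\mathbb{Z}^N\to\mathbb{Z}/\ell$ (identified with its matrix), the quantum torus $\mathcal{T}_\varepsilon(\Lambda)$ is the $\mathcal{A}_\varepsilon^{1/2}$-algebra with basis $\{X^f\mid f\in\mathbb{Z}^N\}$ and product $X^fX^g=\varepsilon^{\Lambda(f,g)/2}X^{f+g}$. A root of unity toric frame of a division algebra $\mathcal{F}_\varepsilon$ over $\mathbb{Q}(\varepsilon^{1/2})$ is a map $M_\varepsilon:\mathbb{Z}^N\to\mathcal{F}_\varepsilon$ for which there is such a $\Lambda$ (the matrix $\Lambda_{M_\varepsilon}$ of the frame) so that $X^f\mapsto M_\varepsilon(f)$ is an $\mathcal{A}_\varepsilon^{1/2}$-algebra embedding $\mathcal{T}_\varepsilon(\Lambda)\hookrightarrow\mathcal{F}_\varepsilon$ and $\mathcal{F}_\varepsilon$ is the division ring of fractions of the image. A root of unity quantum seed is a pair $(M_\varepsilon,\tilde B)$ such that, for some diagonal matrix $D=\mathrm{diag}(d_j,j\in\mathbf{ex})$ with $d_j\in\mathbb{Z}_+$ and $DB$ skew-symmetric, $B$ being the principal part of $\tilde B$ (this $D$ is the skew-symmetrizing matrix of the claim), the $(i,j)$ entry of $\Lambda_{M_\varepsilon}^\top\tilde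 B$ modulo $\ell$ equals $d_j$ if $i=j$ and $0$ otherwise ($i\in[1,N]$, $j\in\mathbf{ex}$). Its mutation at $k\in\mathbf{ex}$ is $(\mu_k(M_\varepsilon),\mu_k(\tilde B))$, where $\mu_k(M_\varepsilon)$ is the toric frame with $\mu_k(M_\varepsilon)(e_i)=M_\varepsilon(e_i)$ for $i\ne k$ and $\mu_k(M_\varepsilon)(e_k)=M_\varepsilon(-e_k+[b^k]_+)+M_\varepsilon(-e_k-[b^k]_-)$; here $b^k$ is the $k$-th column of $\tilde B$, and $[c]_+$, $[c]_-$ are the parts of $c\in\mathbb{Z}^N$ with nonnegative, resp. nonpositive, coordinates. (Its matrix $\Lambda'$ satisfies $\Lambda'(e_i,e_j)=\Lambda(e_i,e_j)$ and $\Lambda'(e_i,e_k)=\Lambda(e_i,-e_k+[b^k]_+)$ for $i,j\neq k$.) For a frame $M_\varepsilon$ put (inside the center of $\mathcal{F}_\varepsilon$) $\mathcal{T}(M_\varepsilon)^\ell_\ge:=\Bbbk[M_\varepsilon(e_i)^{\pm\ell},M_\varepsilon(e_j)^\ell;\ i\in\mathbf{ex}\sqcup\mathbf{inv},\ j\notin\mathbf{ex}\sqcup\mathbf{inv}]$ and $\mathcal{T}_\varepsilon(M_\varepsilon)^\ell_\ge:=\mathcal{A}_\varepsilon^{1/2}[M_\varepsilon(e_i)^{\pm\ell},M_\varepsilon(e_j)^\ell;\ i\in\mathbf{ex}\sqcup\mathbf{inv},\ j\notin\mathbf{ex}\sqcup\mathbf{inv}]$. Then $\mathbf{CU}(M_\varepsilon,\tilde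 B,\mathbf{inv}):=\bigcap\mathcal{T}(M''_\varepsilon)^\ell_\ge$ and $\mathbf{CU}_\varepsilon(M_\varepsilon,\tilde B,\mathbf{inv}):=\bigcap\mathcal{T}_\varepsilon(M''_\varepsilon)^\ell_\ge$, the intersections being over all seeds $(M''_\varepsilon,\tilde B'')$ obtained from $(M_\varepsilon,\tilde B)$ by sequences of mutations. *)

theory Defs
  imports
    "HOL-Analysis.Finite_Cartesian_Product"
    "HOL-Library.Poly_Mapping"
    "HOL-Number_Theory.Cong"
    "HOL-Computational_Algebra.Fraction_Field"
    "HOL-Algebra.Algebraic_Closure_Type"
begin

no_notation fps_nth (infixl \<open>$\<close> 75)

text \<open>
  The index set \<open>[1,N]\<close> is a finite type \<open>'n\<close> (so \<open>N = CARD('n) > 0\<close>), and \<open>\<int>\<^sup>N\<close> is \<open>int ^ 'n\<close> with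
  standard basis vectors \<open>axis i 1\<close>.  An \<open>N \<times> ex\<close> matrix is stored as an \<open>N \<times> N\<close> matrix; columns
  outside \<open>ex\<close> are never used.

  A base ring \<open>A\<close> is a subset of a field \<open>'c\<close>, and an \<open>A\<close>-algebra is a ring type together with a
  structure map that is only relevant on \<open>A\<close>.
\<close>

section \<open>Algebras over a subring\<close>

inductive_set ring_adjoin :: "'r::ring_1 set \<Rightarrow> 'r set \<Rightarrow> 'r set"
  for R S :: "'r set"
where
  base: "r \<in> R \<Longrightarrow> r \<in> ring_adjoin R S"
| gen: "s \<in> S \<Longrightarrow> s \<in> ring_adjoin R S"
| one: "1 \<in> ring_adjoin R S"
| diff: "\<lbrakk>u \<in> ring_adjoin R S; v \<in> ring_adjoin R S\<rbrakk> \<Longrightarrow> u - v \<in> ring_adjoin R S"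
| mult: "\<lbrakk>u \<in> ring_adjoin R S; v \<in> ring_adjoin R S\<rbrakk> \<Longrightarrow> u * v \<in> ring_adjoin R S"

definition algebra_over :: "'c::comm_ring_1 set \<Rightarrow> ('c \<Rightarrow> 'r::ring_1) \<Rightarrow> bool" where
  "algebra_over A \<eta> \<longleftrightarrow>
     \<eta> 1 = 1 \<and>
     (\<forall>a\<in>A. \<forall>b\<in>A. \<eta> (a + b) = \<eta> a + \<eta> b \<and> \<eta> (a * b) = \<eta> a * \<eta> b) \<and>
     (\<forall>a\<in>A. \<forall>u. \<eta> a * u = u * \<eta> a)"

definition algebra_iso ::
  "'c set \<Rightarrow> ('c \<Rightarrow> 'r::ring_1) \<Rightarrow> ('c \<Rightarrow> 's::ring_1) \<Rightarrow> ('r \<Rightarrow> 's) \<Rightarrow> 'r set \<Rightarrow> 's set \<Rightarrow> bool" where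
  "algebra_iso A \<eta> \<sigma> \<phi> S T \<longleftrightarrow>
     bij_betw \<phi> S T \<and> \<phi> 1 = 1 \<and>
     (\<forall>u\<in>S. \<forall>v\<in>S. \<phi> (u + v) = \<phi> u + \<phi> v \<and> \<phi> (u * v) = \<phi> u * \<phi> v) \<and>
     (\<forall>a\<in>A. \<forall>u\<in>S. \<phi> (\<eta> a * u) = \<sigma> a * \<phi> u)"

definition algebra_isomorphic ::
  "'c set \<Rightarrow> ('c \<Rightarrow> 'r::ring_1) \<Rightarrow> ('c \<Rightarrow> 's::ring_1) \<Rightarrow> 'r set \<Rightarrow> 's set \<Rightarrow> bool" where
  "algebra_isomorphic A \<eta> \<sigma> S T \<longleftrightarrow> (\<exists>\<phi>. algebra_iso A \<eta> \<sigma> \<phi> S T)"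

definition fractions :: "'c::field set \<Rightarrow> 'c set" where
  "fractions A = {a / b | a b. a \<in> A \<and> b \<in> A \<and> b \<noteq> 0}"

text \<open>The ring \<open>R[u\<^sub>i\<^sup>\<plusminus>\<^sup>1, u\<^sub>j; i \<in> I, j \<notin> I]\<close>.\<close>

definition mixed_torus :: "'r::division_ring set \<Rightarrow> ('n \<Rightarrow> 'r) \<Rightarrow> 'n set \<Rightarrow> 'r set" where
  "mixed_torus R u I = ring_adjoin R (range u \<union> (\<lambda>i. inverse (u i)) ` I)"

section \<open>Exchange matrices\<close>

definition exchange_matrix :: "'n::finite set \<Rightarrow> ('n \<Rightarrow> int) \<Rightarrow> int ^ 'n ^ 'n \<Rightarrow> bool" where
  "exchange_matrix ex d B \<longleftrightarrow>
     (\<forall>j\<in>ex. d j > 0) \<and> (\<forall>i\<in>ex. \<forall>j\<in>ex. d i * B $ i $ j = - (d j * B $ j $ i))"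

text \<open>The integer division by 2 is exact.\<close>

definition mutate_matrix :: "'n::finite \<Rightarrow> int ^ 'n ^ 'n \<Rightarrow> int ^ 'n ^ 'n" where
  "mutate_matrix k B = (\<chi> i j. if i = k \<or> j = k then - (B $ i $ j)
     else B $ i $ j + (\<bar>B $ i $ k\<bar> * B $ k $ j + B $ i $ k * \<bar>B $ k $ j\<bar>) div 2)"

section \<open>Classical upper cluster algebras\<close>

definition poly_eval :: "('c \<Rightarrow> 'f::comm_ring_1) \<Rightarrow> ('n::finite \<Rightarrow> 'f) \<Rightarrow> (nat ^ 'n \<Rightarrow>\<^sub>0 'c::zero) \<Rightarrow> 'f" where
  "poly_eval \<sigma> x p = (\<Sum>m\<in>Poly_Mapping.keys p. \<sigma> (Poly_Mapping.lookup p m) * (\<Prod>i\<in>UNIV. x i ^ (m $ i)))"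

definition polys_over :: "'c::zero set \<Rightarrow> ('m \<Rightarrow>\<^sub>0 'c) set" where
  "polys_over K = {p. range (Poly_Mapping.lookup p) \<subseteq> K}"

text \<open>
  The map \<open>\<sigma>\<close> makes the field \<open>'f\<close> an extension of the field of fractions \<open>K\<close> of \<open>A\<close>, the \<open>x i\<close> are
  algebraically independent over \<open>K\<close>, and \<open>'f = K(x)\<close>.
\<close>

definition generating_transcendence_basis ::
  "'c::field set \<Rightarrow> ('c \<Rightarrow> 'f::field) \<Rightarrow> ('n::finite \<Rightarrow> 'f) \<Rightarrow> bool" where
  "generating_transcendence_basis A \<sigma> x \<longleftrightarrow>
     algebra_over (fractions A) \<sigma> \<and>
     (\<forall>p\<in>polys_over (fractions A). poly_eval \<sigma> x p = 0 \<longrightarrow> p = 0) \<and>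
     (\<forall>u. \<exists>p\<in>polys_over (fractions A). \<exists>q\<in>polys_over (fractions A).
        poly_eval \<sigma> x q \<noteq> 0 \<and> u = poly_eval \<sigma> x p / poly_eval \<sigma> x q)"

definition seed ::
  "'c::field set \<Rightarrow> ('c \<Rightarrow> 'f::field) \<Rightarrow> 'n::finite set \<Rightarrow> ('n \<Rightarrow> 'f) \<Rightarrow> int ^ 'n ^ 'n \<Rightarrow> bool" where
  "seed A \<sigma> ex x B \<longleftrightarrow> generating_transcendence_basis A \<sigma> x \<and> (\<exists>d. exchange_matrix ex d B)"

definition mutate_seed ::
  "'n::finite \<Rightarrow> ('n \<Rightarrow> 'f::field) \<times> (int ^ 'n ^ 'n) \<Rightarrow> ('n \<Rightarrow> 'f) \<times> (int ^ 'n ^ 'n)" where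
  "mutate_seed k = (\<lambda>(x, B).
     (x(k := ((\<Prod>i | B $ i $ k > 0. x i ^ nat (B $ i $ k)) +
              (\<Prod>i | B $ i $ k < 0. x i ^ nat (- (B $ i $ k)))) / x k),
      mutate_matrix k B))"

definition mutation_equivalent ::
  "'n::finite set \<Rightarrow> ('n \<Rightarrow> 'f::field) \<times> (int ^ 'n ^ 'n) \<Rightarrow> ('n \<Rightarrow> 'f) \<times> (int ^ 'n ^ 'n) \<Rightarrow> bool" where
  "mutation_equivalent ex = (\<lambda>s t. \<exists>k\<in>ex. t = mutate_seed k s)\<^sup>*\<^sup>*"

definition upper_cluster_algebra ::
  "'c set \<Rightarrow> ('c \<Rightarrow> 'f::field) \<Rightarrow> 'n::finite set \<Rightarrow> 'n set \<Rightarrow> ('n \<Rightarrow> 'f) \<Rightarrow> int ^ 'n ^ 'n \<Rightarrow> 'f set" where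
  "upper_cluster_algebra A \<sigma> ex iv x B =
     \<Inter> {mixed_torus (\<sigma> ` A) x'' (ex \<union> iv) | x'' B''. mutation_equivalent ex (x, B) (x'', B'')}"

section \<open>Root of unity quantum tori and toric frames\<close>

text \<open>Throughout, \<open>\<zeta>\<close> stands for \<open>\<epsilon>\<^sup>1\<^sup>/\<^sup>2\<close>.\<close>

definition primitive_root_of_unity :: "nat \<Rightarrow> 'c::field \<Rightarrow> bool" where
  "primitive_root_of_unity l \<zeta> \<longleftrightarrow> l > 0 \<and> \<zeta> ^ l = 1 \<and> (\<forall>m. 0 < m \<and> m < l \<longrightarrow> \<zeta> ^ m \<noteq> 1)"

text \<open>
  A skew-symmetric bicharacter \<open>\<int>\<^sup>N \<times> \<int>\<^sup>N \<rightarrow> \<int>/l\<close> is given by an integer matrix that represents its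
  matrix modulo \<open>l\<close>.
\<close>

definition skew_mod :: "nat \<Rightarrow> int ^ 'n ^ 'n::finite \<Rightarrow> bool" where
  "skew_mod l \<Lambda> \<longleftrightarrow> (\<forall>i j. [\<Lambda> $ i $ j = - (\<Lambda> $ j $ i)] (mod int l))"

definition bichar :: "int ^ 'n ^ 'n \<Rightarrow> int ^ 'n \<Rightarrow> int ^ 'n::finite \<Rightarrow> int" where
  "bichar \<Lambda> f g = (\<Sum>i\<in>UNIV. \<Sum>j\<in>UNIV. f $ i * \<Lambda> $ i $ j * g $ j)"

text \<open>
  Elements of the quantum torus are the \<open>a \<in> polys_over A\<close> with exponents in \<open>\<int>\<^sup>N\<close>; the
  basis element \<open>X\<^sup>f\<close> is \<open>Poly_Mapping.single f 1\<close>, and addition is that of \<open>\<Rightarrow>\<^sub>0\<close>.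
\<close>

definition qtorus_mult ::
  "'c::field \<Rightarrow> int ^ 'n ^ 'n \<Rightarrow> (int ^ 'n::finite \<Rightarrow>\<^sub>0 'c) \<Rightarrow> (int ^ 'n \<Rightarrow>\<^sub>0 'c) \<Rightarrow> (int ^ 'n \<Rightarrow>\<^sub>0 'c)" where
  "qtorus_mult \<zeta> \<Lambda> a b =
     (\<Sum>f\<in>Poly_Mapping.keys a. \<Sum>g\<in>Poly_Mapping.keys b.
        Poly_Mapping.single (f + g)
          (Poly_Mapping.lookup a f * Poly_Mapping.lookup b g * \<zeta> powi bichar \<Lambda> f g))"

definition frame_map :: "('c \<Rightarrow> 'd::ring_1) \<Rightarrow> (int ^ 'n \<Rightarrow> 'd) \<Rightarrow> (int ^ 'n::finite \<Rightarrow>\<^sub>0 'c::zero) \<Rightarrow> 'd" where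
  "frame_map \<eta> M a = (\<Sum>f\<in>Poly_Mapping.keys a. \<eta> (Poly_Mapping.lookup a f) * M f)"

text \<open>
  The division ring \<open>'d\<close> is required to consist of the right fractions of the image; since quantum
  tori are two-sided Ore domains, left fractions would give the same condition.  Injectivity of the
  frame map makes \<open>\<eta>\<close> injective on \<open>A\<close>, so that \<open>'d\<close> is an algebra over the fraction field of \<open>A\<close>,
  and in particular over \<open>\<rat>(\<zeta>)\<close>, in a unique compatible way.
\<close>

definition toric_frame_with ::
  "'c::field set \<Rightarrow> ('c \<Rightarrow> 'd::division_ring) \<Rightarrow> nat \<Rightarrow> 'c \<Rightarrow> int ^ 'n ^ 'n \<Rightarrow> (int ^ 'n::finite \<Rightarrow> 'd) \<Rightarrow> bool" where
  "toric_frame_with A \<eta> l \<zeta> \<Lambda> M \<longleftrightarrow>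
     skew_mod l \<Lambda> \<and>
     frame_map \<eta> M (Poly_Mapping.single 0 1) = 1 \<and>
     (\<forall>a\<in>polys_over A. \<forall>b\<in>polys_over A.
        frame_map \<eta> M (a + b) = frame_map \<eta> M a + frame_map \<eta> M b \<and>
        frame_map \<eta> M (qtorus_mult \<zeta> \<Lambda> a b) = frame_map \<eta> M a * frame_map \<eta> M b) \<and>
     inj_on (frame_map \<eta> M) (polys_over A) \<and>
     (\<forall>u. \<exists>a\<in>polys_over A. \<exists>b\<in>polys_over A.
        frame_map \<eta> M b \<noteq> 0 \<and> u = frame_map \<eta> M a * inverse (frame_map \<eta> M b))"

definition toric_frame ::
  "'c::field set \<Rightarrow> ('c \<Rightarrow> 'd::division_ring) \<Rightarrow> nat \<Rightarrow> 'c \<Rightarrow> (int ^ 'n::finite \<Rightarrow> 'd) \<Rightarrow> bool" where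
  "toric_frame A \<eta> l \<zeta> M \<longleftrightarrow> (\<exists>\<Lambda>. toric_frame_with A \<eta> l \<zeta> \<Lambda> M)"

section \<open>Root of unity quantum seeds\<close>

definition quantum_seed ::
  "'c::field set \<Rightarrow> ('c \<Rightarrow> 'd::division_ring) \<Rightarrow> nat \<Rightarrow> 'c \<Rightarrow> 'n::finite set \<Rightarrow> ('n \<Rightarrow> int) \<Rightarrow>
    (int ^ 'n \<Rightarrow> 'd) \<Rightarrow> int ^ 'n ^ 'n \<Rightarrow> bool" where
  "quantum_seed A \<eta> l \<zeta> ex d M B \<longleftrightarrow>
     exchange_matrix ex d B \<and>
     (\<exists>\<Lambda>. toric_frame_with A \<eta> l \<zeta> \<Lambda> M \<and>
        (\<forall>i. \<forall>j\<in>ex. [(Finite_Cartesian_Product.transpose \<Lambda> ** B) $ i $ j = (if i = j then d j else 0)] (mod int l)))"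

definition pos_part :: "int ^ 'n \<Rightarrow> int ^ 'n::finite" where
  "pos_part c = (\<chi> i. max (c $ i) 0)"

definition neg_part :: "int ^ 'n \<Rightarrow> int ^ 'n::finite" where
  "neg_part c = (\<chi> i. min (c $ i) 0)"

text \<open>
  The mutated frame is given implicitly, as a toric frame with prescribed values on the standard
  basis.  For odd \<open>l\<close> it is unique, because the commutation relations between these values determine
  its matrix modulo \<open>l\<close>.
\<close>

definition quantum_mutation ::
  "'c::field set \<Rightarrow> ('c \<Rightarrow> 'd::division_ring) \<Rightarrow> nat \<Rightarrow> 'c \<Rightarrow> 'n::finite \<Rightarrow>
    (int ^ 'n \<Rightarrow> 'd) \<times> (int ^ 'n ^ 'n) \<Rightarrow> (int ^ 'n \<Rightarrow> 'd) \<times> (int ^ 'n ^ 'n) \<Rightarrow> bool" where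
  "quantum_mutation A \<eta> l \<zeta> k = (\<lambda>(M, B) (M', B').
     toric_frame A \<eta> l \<zeta> M' \<and>
     (\<forall>i. i \<noteq> k \<longrightarrow> M' (axis i 1) = M (axis i 1)) \<and>
     M' (axis k 1) = M (- axis k 1 + pos_part (column k B)) + M (- axis k 1 - neg_part (column k B)) \<and>
     B' = mutate_matrix k B)"

definition quantum_mutation_equivalent ::
  "'c::field set \<Rightarrow> ('c \<Rightarrow> 'd::division_ring) \<Rightarrow> nat \<Rightarrow> 'c \<Rightarrow> 'n::finite set \<Rightarrow>
    (int ^ 'n \<Rightarrow> 'd) \<times> (int ^ 'n ^ 'n) \<Rightarrow> (int ^ 'n \<Rightarrow> 'd) \<times> (int ^ 'n ^ 'n) \<Rightarrow> bool" where
  "quantum_mutation_equivalent A \<eta> l \<zeta> ex = (\<lambda>s t. \<exists>k\<in>ex. quantum_mutation A \<eta> l \<zeta> k s t)\<^sup>*\<^sup>*"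

text \<open>
  The ring \<open>A\<close> is always \<open>k[\<zeta>]\<close>, over which frames are defined; the coefficient ring \<open>R\<close> is \<open>k\<close> for
  \<open>CU\<close> and \<open>k[\<zeta>]\<close> for \<open>CU\<^sub>\<epsilon>\<close>.
\<close>

definition central_upper ::
  "'c set \<Rightarrow> 'c::field set \<Rightarrow> ('c \<Rightarrow> 'd::division_ring) \<Rightarrow> nat \<Rightarrow> 'c \<Rightarrow> 'n::finite set \<Rightarrow> 'n set \<Rightarrow>
    (int ^ 'n \<Rightarrow> 'd) \<Rightarrow> int ^ 'n ^ 'n \<Rightarrow> 'd set" where
  "central_upper R A \<eta> l \<zeta> ex iv M B =
     \<Inter> {mixed_torus (\<eta> ` R) (\<lambda>i. M'' (axis i 1) ^ l) (ex \<union> iv) | M'' B''.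
        quantum_mutation_equivalent A \<eta> l \<zeta> ex (M, B) (M'', B'')}"

section \<open>The base rings inside the algebraic closure\<close>

definition ground_ring :: "'k::idom fract alg_closure set" where
  "ground_ring = range (\<lambda>a. to_ac (Fraction_Field.Fract a 1))"

definition ground_ring_adjoin :: "'k::idom fract alg_closure \<Rightarrow> 'k fract alg_closure set" where
  "ground_ring_adjoin \<zeta> = ring_adjoin ground_ring {\<zeta>}"

end

theory Submission
  imports Defs
begin

text \<open>
  If \<open>v u = q u v\<close> for a primitive \<open>l\<close>-th root of unity \<open>q\<close>, then \<open>(u + v)\<^sup>l = u\<^sup>l + v\<^sup>l\<close>.  The two
  summands of the exchange relation at \<open>k\<close> satisfy this, by the compatibility of \<open>\<Lambda>\<close> and \<open>B\<close>, with \<open>q\<close>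
  the power of \<open>\<zeta>\<close> with exponent \<open>2 d\<^sub>k\<close>, which is primitive as \<open>l\<close> is odd and coprime to \<open>d\<^sub>k\<close>.  So the
  \<open>l\<close>-th powers of the quantum cluster variables obey the classical exchange relations.  These powers
  commute, and they are algebraically independent because \<open>M\<close> is injective on the quantum torus;
  sending them to the classical variables therefore extends to an isomorphism of fraction fields.
  Since every quantum seed can be mutated in every exchangeable direction to a quantum seed again, it
  matches the tori of the two families of seeds with each other, and hence also their intersections.
\<close>

text \<open>The difficulty lies in mutating frames. \<open>quantum_mutation\<close> prescribes only
  the values of some toric frame on the standard basis, so two things are at stake. For existence,
  \<open>new_frame\<close> is built explicitly, and its monomials must be shown to be independent
  and their fractions to exhaust the division ring. Conversely, a given mutated frame need not be
  \<open>new_frame\<close> a priori; its form agrees with \<open>new_form\<close> modulo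
  \<open>l\<close>, which preserves compatibility, and only its values at the basis vectors enter
  the central tori. The isomorphism is fixed once, at the initial seed, as a relation
  \<open>G\<close> closed under differences, products and inverses. The exchange relation uses no
  other operations, so the same \<open>G\<close> matches every later pair of seeds and is never
  rebuilt. All this is done for a coefficient ring \<open>R\<close> inside \<open>A\<close>, which
  covers both claims at once.\<close>

section \<open>Linear combinations with coefficients in a subring\<close>

text \<open>Both \<open>frame_map\<close> and \<open>poly_eval\<close> are instances, with exponents
  in \<open>int ^ 'n\<close> and \<open>nat ^ 'n\<close>; sums and products are thus treated
  once.\<close>

definition lin_eval :: "('c::zero \<Rightarrow> 'r::ring_1) \<Rightarrow> ('m \<Rightarrow> 'r) \<Rightarrow> ('m \<Rightarrow>\<^sub>0 'c) \<Rightarrow> 'r" where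
  "lin_eval \<eta> N p = (\<Sum>m\<in>Poly_Mapping.keys p. \<eta> (Poly_Mapping.lookup p m) * N m)"

text \<open>The factor \<open>c\<close> is a power of \<zeta> for the quantum torus and constantly 1
  for ordinary polynomials.\<close>

definition twisted_mult ::
  "('m::plus \<Rightarrow> 'm \<Rightarrow> 'c::comm_ring_1) \<Rightarrow> ('m \<Rightarrow>\<^sub>0 'c) \<Rightarrow> ('m \<Rightarrow>\<^sub>0 'c) \<Rightarrow> ('m \<Rightarrow>\<^sub>0 'c)" where
  "twisted_mult c p q =
     (\<Sum>m\<in>Poly_Mapping.keys p. \<Sum>n\<in>Poly_Mapping.keys q.
        Poly_Mapping.single (m + n) (Poly_Mapping.lookup p m * Poly_Mapping.lookup q n * c m n))"

lemma frame_map_eq_lin_eval: "frame_map \<eta> M = lin_eval \<eta> M"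
  by (simp add: fun_eq_iff frame_map_def lin_eval_def)

lemma poly_eval_eq_lin_eval: "poly_eval \<sigma> x = lin_eval \<sigma> (\<lambda>m. \<Prod>i\<in>UNIV. x i ^ (m $ i))"
  by (simp add: fun_eq_iff poly_eval_def lin_eval_def)

lemma qtorus_mult_eq_twisted_mult:
  "qtorus_mult \<zeta> \<Lambda> = twisted_mult (\<lambda>f g. \<zeta> powi bichar \<Lambda> f g)"
  by (simp add: fun_eq_iff qtorus_mult_def twisted_mult_def)

lemma lookup_polys_over: "p \<in> polys_over A \<Longrightarrow> Poly_Mapping.lookup p m \<in> A"
  by (auto simp: polys_over_def)

lemma polys_overI: "(\<And>m. Poly_Mapping.lookup p m \<in> A) \<Longrightarrow> p \<in> polys_over A"
  by (auto simp: polys_over_def)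

lemma polys_over_mono: "A \<subseteq> A' \<Longrightarrow> polys_over A \<subseteq> polys_over A'"
  by (auto simp: polys_over_def)

text \<open>An injective relabelling of exponents loses no coefficient; in this way independence of
  frame elements passes to families indexed differently.\<close>

lemma lookup_sum_single_inj:
  assumes "finite I" "inj_on g I" "i \<in> I"
  shows "Poly_Mapping.lookup (\<Sum>j\<in>I. Poly_Mapping.single (g j) (c j)) (g i) = c i"
proof -
  have "Poly_Mapping.lookup (\<Sum>j\<in>I. Poly_Mapping.single (g j) (c j)) (g i)
      = (\<Sum>j\<in>I. if j = i then c j else 0)"
    unfolding lookup_sum by (rule sum.cong) (use assms in \<open>auto simp: lookup_single when_def inj_on_def\<close>)
  then show ?thesis
    using assms by simp
qed

text \<open>The structure map is controlled on the subset \<open>A\<close> only, so closure of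
  \<open>A\<close> is part of the locale and every law below carries membership premises.\<close>

locale subring_algebra =
  fixes A :: "'c::comm_ring_1 set" and \<eta> :: "'c \<Rightarrow> 'r::ring_1"
  assumes one_mem: "1 \<in> A"
    and diff_mem: "a \<in> A \<Longrightarrow> b \<in> A \<Longrightarrow> a - b \<in> A"
    and mult_mem: "a \<in> A \<Longrightarrow> b \<in> A \<Longrightarrow> a * b \<in> A"
    and algebra: "algebra_over A \<eta>"
begin

lemma zero_mem: "0 \<in> A"
  using diff_mem[OF one_mem one_mem] by simp

lemma uminus_mem: "a \<in> A \<Longrightarrow> - a \<in> A"
  using diff_mem[OF zero_mem] by simp

lemma add_mem: "a \<in> A \<Longrightarrow> b \<in> A \<Longrightarrow> a + b \<in> A"
  using diff_mem[of a "- b"] uminus_mem by simp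

lemma power_mem: "a \<in> A \<Longrightarrow> a ^ n \<in> A"
  by (induction n) (auto simp: one_mem mult_mem)

lemma map_one: "\<eta> 1 = 1"
  and map_add: "a \<in> A \<Longrightarrow> b \<in> A \<Longrightarrow> \<eta> (a + b) = \<eta> a + \<eta> b"
  and map_mult: "a \<in> A \<Longrightarrow> b \<in> A \<Longrightarrow> \<eta> (a * b) = \<eta> a * \<eta> b"
  and map_central: "a \<in> A \<Longrightarrow> \<eta> a * u = u * \<eta> a"
  using algebra unfolding algebra_over_def by blast+

lemma map_zero: "\<eta> 0 = 0"
  using map_add[OF zero_mem zero_mem] by simp

lemma map_uminus: "a \<in> A \<Longrightarrow> \<eta> (- a) = - \<eta> a"
  using map_add[of a "- a"] uminus_mem[of a] map_zero
  by (metis add.commute eq_neg_iff_add_eq_0 right_minus)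

lemma map_diff: "a \<in> A \<Longrightarrow> b \<in> A \<Longrightarrow> \<eta> (a - b) = \<eta> a - \<eta> b"
  using map_add[of a "- b"] uminus_mem[of b] map_uminus[of b] by simp

lemma zero_polys: "0 \<in> polys_over A"
  by (rule polys_overI) (simp add: zero_mem)

lemma single_polys: "a \<in> A \<Longrightarrow> Poly_Mapping.single m a \<in> polys_over A"
  by (rule polys_overI) (simp add: lookup_single when_def zero_mem)

lemma add_polys: "p \<in> polys_over A \<Longrightarrow> q \<in> polys_over A \<Longrightarrow> p + q \<in> polys_over A"
  by (rule polys_overI) (simp add: lookup_add add_mem lookup_polys_over)

lemma diff_polys:
  "p \<in> polys_over A \<Longrightarrow> q \<in> polys_over A \<Longrightarrow> p - q \<in> polys_over (A :: 'c set)"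
  by (rule polys_overI) (simp add: lookup_minus diff_mem lookup_polys_over)

lemma sum_polys: "(\<And>i. i \<in> I \<Longrightarrow> P i \<in> polys_over A) \<Longrightarrow> sum P I \<in> polys_over A"
  by (induction I rule: infinite_finite_induct) (auto simp: zero_polys add_polys)

lemma twisted_mult_polys:
  assumes "p \<in> polys_over A" "q \<in> polys_over A" "\<And>m n. c m n \<in> A"
  shows "twisted_mult c p q \<in> polys_over A"
  unfolding twisted_mult_def
  by (intro sum_polys single_polys mult_mem lookup_polys_over assms)

lemma lin_eval_superset:
  assumes "finite S" "Poly_Mapping.keys p \<subseteq> S"
  shows "lin_eval \<eta> N p = (\<Sum>m\<in>S. \<eta> (Poly_Mapping.lookup p m) * N m)"
  unfolding lin_eval_def
  by (rule sum.mono_neutral_left) (use assms in \<open>auto simp: in_keys_iff map_zero\<close>)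

lemma lin_eval_zero: "lin_eval \<eta> N 0 = 0"
  by (simp add: lin_eval_def)

lemma lin_eval_single: "lin_eval \<eta> N (Poly_Mapping.single m a) = \<eta> a * N m"
  by (subst lin_eval_superset[of "{m}"]) auto

lemma lin_eval_add:
  assumes "p \<in> polys_over A" "q \<in> polys_over A"
  shows "lin_eval \<eta> N (p + q) = lin_eval \<eta> N p + lin_eval \<eta> N q"
proof -
  let ?S = "Poly_Mapping.keys p \<union> Poly_Mapping.keys q"
  have "Poly_Mapping.keys (p + q) \<subseteq> ?S"
    by (rule keys_add)
  then show ?thesis
    using assms
    by (simp add: lin_eval_superset[of ?S] lookup_add map_add lookup_polys_over distrib_right sum.distrib)
qed

lemma lin_eval_diff:
  assumes "p \<in> polys_over A" "q \<in> polys_over A"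
  shows "lin_eval \<eta> N (p - q) = lin_eval \<eta> N p - lin_eval \<eta> N q"
  using lin_eval_add[OF diff_polys[OF assms] assms(2), of N] by (simp add: algebra_simps)

lemma lin_eval_sum:
  assumes "\<And>i. i \<in> I \<Longrightarrow> P i \<in> polys_over A"
  shows "lin_eval \<eta> N (sum P I) = (\<Sum>i\<in>I. lin_eval \<eta> N (P i))"
  using assms by (induction I rule: infinite_finite_induct) (auto simp: lin_eval_zero lin_eval_add sum_polys)

lemma lin_eval_sum_single:
  assumes "\<And>i. i \<in> I \<Longrightarrow> c i \<in> A"
  shows "lin_eval \<eta> N (\<Sum>i\<in>I. Poly_Mapping.single (g i) (c i)) = (\<Sum>i\<in>I. \<eta> (c i) * N (g i))"
  by (simp add: lin_eval_sum single_polys assms lin_eval_single)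

text \<open>Coefficients are central in the image, so they can be moved past \<open>N m\<close> and
  the rule for monomials extends bilinearly.\<close>

lemma lin_eval_twisted_mult:
  assumes p: "p \<in> polys_over A" and q: "q \<in> polys_over A" and c: "\<And>m n. c m n \<in> A"
    and N: "\<And>m n. N m * N n = \<eta> (c m n) * N (m + n)"
  shows "lin_eval \<eta> N (twisted_mult c p q) = lin_eval \<eta> N p * lin_eval \<eta> N q"
proof -
  have *: "\<eta> (Poly_Mapping.lookup p m * Poly_Mapping.lookup q n * c m n) * N (m + n)
      = (\<eta> (Poly_Mapping.lookup p m) * N m) * (\<eta> (Poly_Mapping.lookup q n) * N n)" for m n
  proof -
    let ?a = "Poly_Mapping.lookup p m" and ?b = "Poly_Mapping.lookup q n"
    have "\<eta> (?a * ?b * c m n) * N (m + n) = \<eta> ?a * (\<eta> ?b * N m) * N n"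
      using p q c by (simp add: map_mult mult_mem lookup_polys_over mult.assoc flip: N)
    also have "\<eta> ?b * N m = N m * \<eta> ?b"
      by (rule map_central[OF lookup_polys_over[OF q]])
    finally show ?thesis
      by (simp add: mult.assoc)
  qed
  show ?thesis
    unfolding twisted_mult_def lin_eval_def[of _ _ p] lin_eval_def[of _ _ q] sum_product
    by (simp add: lin_eval_sum single_polys sum_polys lin_eval_single mult_mem lookup_polys_over p q c *)
qed

end

section \<open>The binomial theorem at a root of unity\<close>

text \<open>Defined by the Pascal recursion and not as a quotient of products of factors
  \<open>q ^ i - 1\<close>, since such factors vanish at a root of unity.\<close>

fun gauss_binomial :: "'c::comm_ring_1 \<Rightarrow> nat \<Rightarrow> nat \<Rightarrow> 'c" where
  "gauss_binomial q n 0 = 1"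
| "gauss_binomial q 0 (Suc j) = 0"
| "gauss_binomial q (Suc n) (Suc j) = gauss_binomial q n j + q ^ Suc j * gauss_binomial q n (Suc j)"

lemma gauss_binomial_eq_0: "n < j \<Longrightarrow> gauss_binomial q n j = 0"
  by (induction q n j rule: gauss_binomial.induct) auto

lemma gauss_binomial_self: "gauss_binomial q n n = 1"
  by (induction n) (auto simp: gauss_binomial_eq_0)

text \<open>A division-free form of the quotient formula. The induction on \<open>n\<close> keeps
  \<open>j\<close> arbitrary because the step uses the hypothesis at \<open>j\<close> and at its
  predecessor.\<close>

lemma gauss_binomial_absorption:
  "gauss_binomial q (Suc n) (Suc j) * (q ^ Suc j - 1) = (q ^ Suc n - 1) * gauss_binomial q n j"
proof (induction n arbitrary: j)
  case 0
  then show ?case by (cases j) auto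
next
  case (Suc n)
  \<comment> \<open>This brings the second term of the Pascal rule to the same Gaussian coefficient
    as the first; for positive \<open>j\<close> it combines the recursion with the hypothesis at
    \<open>j - 1\<close>.\<close>
  have *: "(q ^ Suc n - 1) * (q ^ Suc j * gauss_binomial q n j)
      = (q ^ Suc (Suc n) - q ^ Suc j) * gauss_binomial q (Suc n) j"
  proof (cases j)
    case 0
    then show ?thesis by (simp add: algebra_simps)
  next
    case (Suc i)
    have "(q ^ Suc n - 1) * (q ^ j * gauss_binomial q n j)
        = (q ^ Suc n - 1) * gauss_binomial q (Suc n) j - (q ^ Suc n - 1) * gauss_binomial q n i"
      by (simp add: Suc algebra_simps)
    also have "\<dots> = (q ^ Suc n - 1) * gauss_binomial q (Suc n) j
        - gauss_binomial q (Suc n) j * (q ^ j - 1)"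
      using Suc.IH[of i] Suc by simp
    also have "\<dots> = (q ^ Suc n - q ^ j) * gauss_binomial q (Suc n) j"
      by (simp add: algebra_simps)
    finally have "q * ((q ^ Suc n - 1) * (q ^ j * gauss_binomial q n j))
        = q * ((q ^ Suc n - q ^ j) * gauss_binomial q (Suc n) j)"
      by simp
    then show ?thesis
      by (simp add: algebra_simps)
  qed
  have "gauss_binomial q (Suc (Suc n)) (Suc j) * (q ^ Suc j - 1)
      = gauss_binomial q (Suc n) j * (q ^ Suc j - 1)
        + q ^ Suc j * (gauss_binomial q (Suc n) (Suc j) * (q ^ Suc j - 1))"
    by (simp only: gauss_binomial.simps(3)[of q "Suc n"] distrib_right mult.assoc)
  also have "q ^ Suc j * (gauss_binomial q (Suc n) (Suc j) * (q ^ Suc j - 1))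
      = (q ^ Suc (Suc n) - q ^ Suc j) * gauss_binomial q (Suc n) j"
    by (simp only: Suc.IH * flip: mult.left_commute[of "q ^ Suc n - 1"])
  finally show ?case
    by (simp only: left_diff_distrib right_diff_distrib mult.commute) (simp only: algebra_simps)
qed

text \<open>In the absorption identity the right side contains \<open>q ^ l - 1 = 0\<close>, and the
  nonzero factor \<open>q ^ j - 1\<close> on the left cancels in an integral domain.\<close>

lemma gauss_binomial_root_of_unity:
  fixes q :: "'c::idom"
  assumes "q ^ l = 1" "0 < j" "j < l" "q ^ j \<noteq> 1"
  shows "gauss_binomial q l j = 0"
proof -
  obtain n i where "l = Suc n" "j = Suc i"
    using assms by (metis less_nat_zero_code not0_implies_Suc)
  then show ?thesis
    using gauss_binomial_absorption[of q n i] assms by simp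
qed

context subring_algebra
begin

lemma gauss_binomial_mem: "q \<in> A \<Longrightarrow> gauss_binomial q n j \<in> A"
  by (induction q n j rule: gauss_binomial.induct) (auto simp: one_mem zero_mem add_mem mult_mem power_mem)

lemma power_q_commute:
  assumes q: "q \<in> A" and vu: "v * u = \<eta> q * (u * v)"
  shows "v * u ^ j = \<eta> (q ^ j) * (u ^ j * v)"
proof (induction j)
  case (Suc j)
  have "v * u ^ Suc j = (v * u) * u ^ j"
    by (simp add: mult.assoc)
  also have "\<dots> = \<eta> q * (u * (v * u ^ j))"
    by (simp add: vu mult.assoc)
  also have "\<dots> = \<eta> q * (u * (\<eta> (q ^ j) * (u ^ j * v)))"
    by (simp add: Suc)
  also have "\<dots> = \<eta> q * (\<eta> (q ^ j) * (u * (u ^ j * v)))"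
    using map_central[OF power_mem[OF q], of j u] by (metis mult.assoc)
  finally show ?case
    using q by (simp add: map_mult power_mem mult.assoc)
qed (simp add: map_one)

lemma q_binomial_theorem:
  assumes q: "q \<in> A" and vu: "v * u = \<eta> q * (u * v)"
  shows "(u + v) ^ n = (\<Sum>j\<le>n. \<eta> (gauss_binomial q n j) * (u ^ j * v ^ (n - j)))"
proof (induction n)
  case 0
  then show ?case by (simp add: map_one)
next
  case (Suc n)
  let ?c = "gauss_binomial q"
  have "(u + v) ^ Suc n = u * (u + v) ^ n + v * (u + v) ^ n"
    by (simp add: distrib_right)
  also have "u * (u + v) ^ n = (\<Sum>j\<le>n. \<eta> (?c n j) * (u ^ Suc j * v ^ (n - j)))"
    unfolding Suc sum_distrib_left
    by (rule sum.cong)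
      (use map_central[OF gauss_binomial_mem[OF q], of n _ u] in \<open>auto simp flip: mult.assoc\<close>)
  also have "v * (u + v) ^ n = (\<Sum>j\<le>n. \<eta> (q ^ j * ?c n j) * (u ^ j * v ^ (Suc n - j)))"
    unfolding Suc sum_distrib_left
  proof (rule sum.cong)
    fix j assume "j \<in> {..n}"
    then have *: "v ^ (Suc n - j) = v * v ^ (n - j)"
      by (simp add: Suc_diff_le)
    have "v * (\<eta> (?c n j) * (u ^ j * v ^ (n - j))) = \<eta> (?c n j) * ((v * u ^ j) * v ^ (n - j))"
      using map_central[OF gauss_binomial_mem[OF q], of n j v] by (metis mult.assoc)
    also have "\<dots> = \<eta> (?c n j) * \<eta> (q ^ j) * (u ^ j * v ^ (Suc n - j))"
      unfolding power_q_commute[OF q vu] * by (simp add: mult.assoc)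
    also have "\<eta> (?c n j) * \<eta> (q ^ j) = \<eta> (q ^ j * ?c n j)"
      using q map_central[OF power_mem[OF q]] by (simp add: map_mult power_mem gauss_binomial_mem)
    finally show "v * (\<eta> (?c n j) * (u ^ j * v ^ (n - j))) = \<eta> (q ^ j * ?c n j) * (u ^ j * v ^ (Suc n - j))" .
  qed simp
  \<comment> \<open>The extra term has coefficient \<open>gauss_binomial q n (Suc n) = 0\<close>.
    With it, splitting off the term at 0 and shifting the index aligns this sum with the other
    one.\<close>
  also have "(\<Sum>j\<le>n. \<eta> (q ^ j * ?c n j) * (u ^ j * v ^ (Suc n - j)))
      = (\<Sum>j\<le>Suc n. \<eta> (q ^ j * ?c n j) * (u ^ j * v ^ (Suc n - j)))"
    by (simp add: gauss_binomial_eq_0 map_zero)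
  also have "(\<Sum>j\<le>n. \<eta> (?c n j) * (u ^ Suc j * v ^ (n - j))) + \<dots>
      = v ^ Suc n + (\<Sum>j\<le>n. (\<eta> (?c n j) + \<eta> (q ^ Suc j * ?c n (Suc j))) * (u ^ Suc j * v ^ (n - j)))"
    unfolding sum.atMost_Suc_shift
    by (simp add: map_one sum.distrib distrib_right del: sum.atMost_Suc)
  also have "\<dots> = v ^ Suc n + (\<Sum>j\<le>n. \<eta> (?c (Suc n) (Suc j)) * (u ^ Suc j * v ^ (n - j)))"
    using q by (simp add: map_add mult_mem power_mem gauss_binomial_mem del: power_Suc)
  also have "\<dots> = (\<Sum>j\<le>Suc n. \<eta> (?c (Suc n) j) * (u ^ j * v ^ (Suc n - j)))"
    unfolding sum.atMost_Suc_shift by (simp add: map_one)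
  finally show ?case .
qed

end

section \<open>Quantum tori at a root of unity\<close>

lemma bichar_add_left: "bichar \<Lambda> (f + f') g = bichar \<Lambda> f g + bichar \<Lambda> f' g"
  and bichar_add_right: "bichar \<Lambda> f (g + g') = bichar \<Lambda> f g + bichar \<Lambda> f g'"
  by (simp_all add: bichar_def algebra_simps sum.distrib)

lemma bichar_scale_left: "bichar \<Lambda> (c *s f) g = c * bichar \<Lambda> f g"
  and bichar_scale_right: "bichar \<Lambda> f (c *s g) = c * bichar \<Lambda> f g"
  by (simp_all add: bichar_def sum_distrib_left mult.assoc mult.left_commute)

lemma bichar_uminus_left: "bichar \<Lambda> (- f) g = - bichar \<Lambda> f g"
  and bichar_uminus_right: "bichar \<Lambda> f (- g) = - bichar \<Lambda> f g"
  by (simp_all add: bichar_def sum_negf)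

lemma bichar_diff_left: "bichar \<Lambda> (f - f') g = bichar \<Lambda> f g - bichar \<Lambda> f' g"
  and bichar_diff_right: "bichar \<Lambda> f (g - g') = bichar \<Lambda> f g - bichar \<Lambda> f g'"
  by (simp_all add: bichar_def algebra_simps sum_subtractf)

lemma bichar_zero_left: "bichar \<Lambda> 0 g = 0" and bichar_zero_right: "bichar \<Lambda> f 0 = 0"
  by (simp_all add: bichar_def)

lemma bichar_sum_left: "bichar \<Lambda> (\<Sum>i\<in>I. F i) g = (\<Sum>i\<in>I. bichar \<Lambda> (F i) g)"
  and bichar_sum_right: "bichar \<Lambda> f (\<Sum>i\<in>I. F i) = (\<Sum>i\<in>I. bichar \<Lambda> f (F i))"
  by (induction I rule: infinite_finite_induct)
    (simp_all add: bichar_zero_left bichar_zero_right bichar_add_left bichar_add_right)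

lemmas bichar_linear =
  bichar_add_left bichar_add_right bichar_scale_left bichar_scale_right bichar_uminus_left
  bichar_uminus_right bichar_diff_left bichar_diff_right bichar_zero_left bichar_zero_right

lemma sum_axis_left: "(\<Sum>m\<in>UNIV. axis i (1::int) $ m * c m) = c i"
  by (simp add: axis_def if_distrib[of "\<lambda>x. x * _"] cong: if_cong)

lemma sum_axis_right: "(\<Sum>m\<in>UNIV. c m * axis i (1::int) $ m) = c i"
  by (simp add: axis_def if_distrib[of "\<lambda>x. _ * x"] cong: if_cong)

lemma bichar_axis: "bichar \<Lambda> (axis i 1) (axis j 1) = \<Lambda> $ i $ j"
  by (simp add: bichar_def sum_axis_right sum_axis_left)

lemma bichar_axis_right: "bichar \<Lambda> c (axis i 1) = (\<Sum>m\<in>UNIV. c $ m * \<Lambda> $ m $ i)"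
  by (simp add: bichar_def sum_axis_right)

lemma bichar_expand:
  "bichar \<Lambda> f g = (\<Sum>i\<in>UNIV. g $ i * bichar \<Lambda> f (axis i 1))"
proof -
  have "bichar \<Lambda> f g = bichar \<Lambda> f (\<Sum>i\<in>UNIV. g $ i *s axis i 1)"
    by (simp add: basis_expansion)
  then show ?thesis
    by (simp add: bichar_sum_right bichar_scale_right)
qed

lemma bichar_skew_mod:
  assumes "skew_mod l \<Lambda>"
  shows "[bichar \<Lambda> f g = - bichar \<Lambda> g f] (mod int l)"
proof -
  have "[bichar \<Lambda> f g = (\<Sum>i\<in>UNIV. \<Sum>j\<in>UNIV. f $ i * - (\<Lambda> $ j $ i) * g $ j)] (mod int l)"
    unfolding bichar_def
    by (intro cong_sum cong_mult cong_refl) (use assms in \<open>simp add: skew_mod_def\<close>)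
  also have "(\<Sum>i\<in>UNIV. \<Sum>j\<in>UNIV. f $ i * - (\<Lambda> $ j $ i) * g $ j)
      = (\<Sum>j\<in>UNIV. \<Sum>i\<in>UNIV. - (g $ j * \<Lambda> $ j $ i * f $ i))"
    by (subst sum.swap) (simp add: algebra_simps)
  also have "\<dots> = - bichar \<Lambda> g f"
    by (simp add: bichar_def sum_negf)
  finally show ?thesis .
qed

text \<open>Skew-symmetry only gives twice the value; odd \<open>l\<close> allows cancelling the 2.
  This is why powers of a frame element are again frame elements, without a twist
  (\<open>M_power\<close>).\<close>

lemma bichar_self_mod:
  assumes "skew_mod l \<Lambda>" "odd l"
  shows "[bichar \<Lambda> f f = 0] (mod int l)"
proof -
  have "int l dvd 2 * bichar \<Lambda> f f"
    using bichar_skew_mod[OF assms(1), of f f] by (simp add: cong_iff_dvd_diff)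
  moreover have "coprime (int l) 2"
    using assms(2) by simp
  ultimately show ?thesis
    by (simp add: cong_0_iff coprime_dvd_mult_right_iff)
qed

locale root_of_unity_algebra = subring_algebra A \<eta>
  for A :: "'c::field set" and \<eta> :: "'c \<Rightarrow> 'd::division_ring" +
  fixes l :: nat and \<zeta> :: 'c
  assumes zeta_mem: "\<zeta> \<in> A"
    and primitive: "primitive_root_of_unity l \<zeta>"
    and odd_l: "odd l"
    and two_nonzero: "(2::'c) \<noteq> 0"
begin

text \<open>A power of \<epsilon> to a half-integer exponent; hence the factors 2 in all commutation
  rules.\<close>

definition twist :: "int \<Rightarrow> 'd" where
  "twist n = \<eta> (\<zeta> powi n)"

lemma l_pos: "0 < l"
  using primitive by (simp add: primitive_root_of_unity_def)

lemma zeta_nonzero: "\<zeta> \<noteq> 0"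
  using primitive by (auto simp: primitive_root_of_unity_def power_0_left)

text \<open>\<open>A\<close> is not assumed to be closed under inverses; a negative power of \<zeta>
  lies in it because it equals a nonnegative one.\<close>

lemma zeta_powi_mod: "\<zeta> powi n = \<zeta> ^ nat (n mod int l)"
proof -
  have "\<zeta> powi n = \<zeta> powi (int l * (n div int l) + n mod int l)"
    by simp
  also have "\<dots> = (\<zeta> powi int l) powi (n div int l) * \<zeta> powi (n mod int l)"
    by (simp only: power_int_add[OF disjI1[OF zeta_nonzero]] power_int_mult)
  also have "\<zeta> powi int l = 1"
    using primitive by (simp add: primitive_root_of_unity_def)
  finally show ?thesis
    using l_pos by (simp add: power_int_def)
qed

lemma zeta_powi_mem: "\<zeta> powi n \<in> A"
  unfolding zeta_powi_mod by (rule power_mem[OF zeta_mem])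

lemma zeta_powi_cong: "[m = n] (mod int l) \<Longrightarrow> \<zeta> powi m = \<zeta> powi n"
  unfolding zeta_powi_mod by (simp add: cong_def)

lemma zeta_powi_eq_1_iff: "\<zeta> powi n = 1 \<longleftrightarrow> int l dvd n"
proof
  assume *: "\<zeta> powi n = 1"
  have "nat (n mod int l) < l"
    using l_pos by (simp add: nat_less_iff)
  then have "nat (n mod int l) = 0"
    using * primitive by (metis gr0I primitive_root_of_unity_def zeta_powi_mod)
  then have "n mod int l = 0"
    using l_pos pos_mod_sign[of "int l" n] by linarith
  then show "int l dvd n"
    by (simp add: dvd_eq_mod_eq_0)
qed (simp add: zeta_powi_mod)

lemma twist_cong: "[m = n] (mod int l) \<Longrightarrow> twist m = twist n"
  unfolding twist_def by (simp add: zeta_powi_cong)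

lemma twist_0: "twist 0 = 1"
  by (simp add: twist_def map_one)

lemma twist_add: "twist (m + n) = twist m * twist n"
  by (simp add: twist_def power_int_add zeta_nonzero map_mult zeta_powi_mem)

lemma twist_central: "twist n * u = u * twist n"
  unfolding twist_def by (rule map_central[OF zeta_powi_mem])

lemma twist_left_commute: "u * (twist n * v) = twist n * (u * v)"
  by (metis mult.assoc twist_central)

lemma twist_nonzero: "twist n \<noteq> 0"
  using twist_add[of n "- n"] twist_0 by auto

lemma twist_twist: "twist m * (twist n * u) = twist (m + n) * u"
  by (simp add: twist_add mult.assoc)

lemma power_add_root_of_unity:
  assumes m: "coprime m (int l)" and vu: "v * u = twist m * (u * v)"
  shows "(u + v) ^ l = u ^ l + v ^ l"
proof -
  let ?q = "\<zeta> powi m"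
  have powi: "?q ^ j = \<zeta> powi (m * int j)" for j
    by (simp add: power_int_mult)
  have c0: "gauss_binomial ?q l j = 0" if "0 < j" "j < l" for j
  proof (rule gauss_binomial_root_of_unity)
    show "?q ^ l = 1"
      unfolding powi by (simp add: zeta_powi_eq_1_iff)
    have "\<not> int l dvd int j"
      using that by (auto dest: zdvd_imp_le)
    then show "?q ^ j \<noteq> 1"
      using m unfolding powi zeta_powi_eq_1_iff
      by (simp add: coprime_dvd_mult_right_iff coprime_commute)
  qed (use that in auto)
  have "(u + v) ^ l = (\<Sum>j\<le>l. \<eta> (gauss_binomial ?q l j) * (u ^ j * v ^ (l - j)))"
    by (rule q_binomial_theorem) (use vu in \<open>simp_all add: zeta_powi_mem twist_def\<close>)
  also have "\<dots> = (\<Sum>j\<in>{0, l}. \<eta> (gauss_binomial ?q l j) * (u ^ j * v ^ (l - j)))"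
    by (rule sum.mono_neutral_right) (auto simp: c0 map_zero)
  also have "\<dots> = u ^ l + v ^ l"
    using l_pos by (simp add: gauss_binomial_self map_one)
  finally show ?thesis .
qed

end

text \<open>Independence and generation are left out on purpose: the mutated frame is first
  recognised as a map of this kind, and its span \<open>combs\<close> is then available for proving
  generation.\<close>

locale quantum_torus_map = root_of_unity_algebra A \<eta> l \<zeta>
  for A :: "'c::field set" and \<eta> :: "'c \<Rightarrow> 'd::division_ring" and l \<zeta> +
  fixes \<Lambda> :: "int ^ 'n ^ 'n::finite" and M :: "int ^ 'n \<Rightarrow> 'd"
  assumes skew: "skew_mod l \<Lambda>"
    and M_0: "M 0 = 1"
    and M_mult: "M f * M g = twist (bichar \<Lambda> f g) * M (f + g)"
begin

lemmas bichar_skew = bichar_skew_mod[OF skew]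
lemmas bichar_self = bichar_self_mod[OF skew odd_l]

lemma M_nonzero: "M f \<noteq> 0"
proof
  assume "M f = 0"
  then have "twist (bichar \<Lambda> f (- f)) * M 0 = 0"
    using M_mult[of f "- f"] by simp
  then show False
    by (simp add: twist_nonzero M_0)
qed

lemma M_add: "M (f + g) = twist (- bichar \<Lambda> f g) * (M f * M g)"
  by (simp add: M_mult twist_twist twist_0)

lemma M_commute: "M g * M f = twist (2 * bichar \<Lambda> g f) * (M f * M g)"
proof -
  have "twist (bichar \<Lambda> g f) = twist (2 * bichar \<Lambda> g f + bichar \<Lambda> f g)"
    using bichar_skew[of f g] by (intro twist_cong) (simp add: cong_iff_dvd_diff dvd_diff_commute)
  then show ?thesis
    by (simp add: M_mult add.commute twist_twist)
qed

lemma M_power: "M f ^ n = M (int n *s f)"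
proof (induction n)
  case 0
  then show ?case by (simp add: M_0)
next
  case (Suc n)
  have "bichar \<Lambda> f (int n *s f) = int n * bichar \<Lambda> f f"
    by (simp add: bichar_linear)
  then have "[bichar \<Lambda> f (int n *s f) = 0] (mod int l)"
    using cong_mult[OF cong_refl bichar_self, of "int n" f] by simp
  then have "twist (bichar \<Lambda> f (int n *s f)) = 1"
    using twist_cong twist_0 by metis
  moreover have "int (Suc n) *s f = f + int n *s f"
    by (simp add: vec_eq_iff distrib_right)
  ultimately show ?case
    using Suc by (simp add: M_mult)
qed

text \<open>For \<open>S\<close> a level set of one coordinate this is a graded piece of the torus,
  for \<open>S = UNIV\<close> its whole image.\<close>

definition combs :: "(int ^ 'n) set \<Rightarrow> 'd set" where
  "combs S = lin_eval \<eta> M ` {p \<in> polys_over A. Poly_Mapping.keys p \<subseteq> S}"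

lemma combsI: "p \<in> polys_over A \<Longrightarrow> Poly_Mapping.keys p \<subseteq> S \<Longrightarrow> lin_eval \<eta> M p \<in> combs S"
  by (simp add: combs_def)

lemma combs_zero: "0 \<in> combs S"
  using combsI[OF zero_polys] by (simp add: lin_eval_zero)

lemma combs_add: "u \<in> combs S \<Longrightarrow> v \<in> combs S \<Longrightarrow> u + v \<in> combs S"
  unfolding combs_def
proof (elim imageE, clarsimp)
  fix p q
  assume pq: "p \<in> polys_over A" "q \<in> polys_over A"
    "Poly_Mapping.keys p \<subseteq> S" "Poly_Mapping.keys q \<subseteq> S"
  then have "Poly_Mapping.keys (p + q) \<subseteq> S"
    using keys_add[of p q] by blast
  then show "lin_eval \<eta> M p + lin_eval \<eta> M q \<in> lin_eval \<eta> M ` {p \<in> polys_over A. Poly_Mapping.keys p \<subseteq> S}"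
    using pq by (intro image_eqI[of _ _ "p + q"]) (simp_all add: lin_eval_add add_polys)
qed

lemma combs_sum: "(\<And>i. i \<in> I \<Longrightarrow> U i \<in> combs S) \<Longrightarrow> sum U I \<in> combs S"
  by (induction I rule: infinite_finite_induct) (auto simp: combs_zero combs_add)

lemma combs_monomial: "a \<in> A \<Longrightarrow> f \<in> S \<Longrightarrow> \<eta> a * M f \<in> combs S"
  using combsI[OF single_polys, of a f S] by (auto simp: lin_eval_single)

lemma combs_M: "f \<in> S \<Longrightarrow> M f \<in> combs S"
  using combs_monomial[OF one_mem] by (simp add: map_one)

lemma combs_mult:
  assumes "u \<in> combs S" "v \<in> combs T" "\<And>f g. f \<in> S \<Longrightarrow> g \<in> T \<Longrightarrow> f + g \<in> U"
  shows "u * v \<in> combs U"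
proof -
  obtain p q where p: "p \<in> polys_over A" "Poly_Mapping.keys p \<subseteq> S" "u = lin_eval \<eta> M p"
    and q: "q \<in> polys_over A" "Poly_Mapping.keys q \<subseteq> T" "v = lin_eval \<eta> M q"
    using assms by (auto simp: combs_def)
  let ?a = "Poly_Mapping.lookup p" and ?b = "Poly_Mapping.lookup q"
  have "u * v = (\<Sum>f\<in>Poly_Mapping.keys p. \<Sum>g\<in>Poly_Mapping.keys q. (\<eta> (?a f) * M f) * (\<eta> (?b g) * M g))"
    by (simp add: p q lin_eval_def sum_product)
  also have "\<dots> \<in> combs U"
  proof (intro combs_sum)
    fix f g assume fg: "f \<in> Poly_Mapping.keys p" "g \<in> Poly_Mapping.keys q"
    have "(\<eta> (?a f) * M f) * (\<eta> (?b g) * M g) = \<eta> (?a f) * (\<eta> (?b g) * M f) * M g"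
      using map_central[OF lookup_polys_over[OF q(1)], of g "M f"] by (simp add: mult.assoc)
    also have "\<dots> = \<eta> (?a f * ?b g * \<zeta> powi bichar \<Lambda> f g) * M (f + g)"
      using p q
      by (simp add: map_mult mult_mem lookup_polys_over zeta_powi_mem mult.assoc M_mult twist_def)
    also have "\<dots> \<in> combs U"
      using p q fg assms(3)
      by (intro combs_monomial mult_mem lookup_polys_over zeta_powi_mem) auto
    finally show "(\<eta> (?a f) * M f) * (\<eta> (?b g) * M g) \<in> combs U" .
  qed
  finally show ?thesis .
qed

lemma combs_twist: "u \<in> combs S \<Longrightarrow> twist n * u \<in> combs S"
  using combs_mult[OF combs_monomial[OF zeta_powi_mem, of 0 "{0}" n], of u S S]
  by (simp add: M_0 twist_def)

lemma combs_power: "u \<in> combs UNIV \<Longrightarrow> u ^ n \<in> combs UNIV"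
proof (induction n)
  case 0
  then show ?case using combs_M[of 0 UNIV] by (simp add: M_0)
next
  case (Suc n)
  then show ?case by (simp add: combs_mult[of _ UNIV _ UNIV])
qed

end

locale toric_frame_map = quantum_torus_map A \<eta> l \<zeta> \<Lambda> M
  for A :: "'c::field set" and \<eta> :: "'c \<Rightarrow> 'd::division_ring" and l \<zeta>
    and \<Lambda> :: "int ^ 'n ^ 'n::finite" and M +
  assumes independent: "p \<in> polys_over A \<Longrightarrow> lin_eval \<eta> M p = 0 \<Longrightarrow> p = 0"
    and fraction: "\<exists>a\<in>combs UNIV. \<exists>b\<in>combs UNIV. b \<noteq> 0 \<and> u = a * inverse b"
begin

lemma map_eq_0_iff: "a \<in> A \<Longrightarrow> \<eta> a = 0 \<longleftrightarrow> a = 0"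
  using independent[OF single_polys, of a 0] map_zero
  by (metis lin_eval_single lookup_single_eq lookup_zero mult_zero_left)

lemma map_eq_iff: "a \<in> A \<Longrightarrow> b \<in> A \<Longrightarrow> \<eta> a = \<eta> b \<longleftrightarrow> a = b"
  using map_eq_0_iff[of "a - b"] by (simp add: diff_mem map_diff)

lemma twist_eq_iff: "twist m = twist n \<longleftrightarrow> [m = n] (mod int l)"
proof -
  have "twist m = twist n \<longleftrightarrow> twist (m - n) = 1"
    using twist_add[of "m - n" n] by (simp add: twist_nonzero)
  also have "\<dots> \<longleftrightarrow> \<zeta> powi (m - n) = 1"
    using map_eq_iff[OF zeta_powi_mem one_mem] by (simp add: twist_def map_one)
  finally show ?thesis
    by (simp add: zeta_powi_eq_1_iff cong_iff_dvd_diff)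
qed

text \<open>Summands of different heights have disjoint supports, so nothing can cancel between
  them.\<close>

lemma graded_independent:
  assumes "finite T" "inj_on ht T" "\<And>t. t \<in> T \<Longrightarrow> u t \<in> combs {f. f $ k = ht t}"
    and "(\<Sum>t\<in>T. u t) = 0" and "t \<in> T"
  shows "u t = 0"
proof -
  have "\<forall>t\<in>T. \<exists>p. p \<in> polys_over A \<and> Poly_Mapping.keys p \<subseteq> {f. f $ k = ht t} \<and> u t = lin_eval \<eta> M p"
    using assms(3) by (auto simp: combs_def)
  then obtain p where p: "\<And>t. t \<in> T \<Longrightarrow> p t \<in> polys_over A"
      "\<And>t. t \<in> T \<Longrightarrow> Poly_Mapping.keys (p t) \<subseteq> {f. f $ k = ht t}"
      "\<And>t. t \<in> T \<Longrightarrow> u t = lin_eval \<eta> M (p t)"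
    by metis
  have "lin_eval \<eta> M (sum p T) = 0"
    using assms(4) p by (simp add: lin_eval_sum)
  then have 0: "sum p T = 0"
    using independent sum_polys p by blast
  have "p t = 0"
  proof (rule poly_mapping_eqI)
    fix f
    show "Poly_Mapping.lookup (p t) f = Poly_Mapping.lookup 0 f"
    proof (cases "f $ k = ht t")
      case True
      have "Poly_Mapping.lookup (p s) f = 0" if "s \<in> T - {t}" for s
        using that p(2)[of s] True assms(2,5) by (auto simp: inj_on_def in_keys_iff)
      then have "Poly_Mapping.lookup (sum p T) f = Poly_Mapping.lookup (p t) f"
        unfolding lookup_sum using assms(1,5) by (subst sum.remove) auto
      then show ?thesis using 0 by simp
    next
      case False
      then show ?thesis using p(2)[OF assms(5)] by (auto simp: in_keys_iff)
    qed
  qed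
  then show ?thesis using p(3)[OF assms(5)] by (simp add: lin_eval_zero)
qed

end

context root_of_unity_algebra
begin

text \<open>Multiplicativity is tested on single monomials in one direction and extended bilinearly
  in the other; injectivity becomes a trivial kernel.\<close>

lemma toric_frame_with_iff:
  "toric_frame_with A \<eta> l \<zeta> \<Lambda> M \<longleftrightarrow> toric_frame_map A \<eta> l \<zeta> \<Lambda> M"
proof
  assume "toric_frame_with A \<eta> l \<zeta> \<Lambda> M"
  then have skew: "skew_mod l \<Lambda>" and one: "lin_eval \<eta> M (Poly_Mapping.single 0 1) = 1"
    and mult: "\<And>a b. a \<in> polys_over A \<Longrightarrow> b \<in> polys_over A \<Longrightarrow>
        lin_eval \<eta> M (qtorus_mult \<zeta> \<Lambda> a b) = lin_eval \<eta> M a * lin_eval \<eta> M b"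
    and inj: "inj_on (lin_eval \<eta> M) (polys_over A)"
    and frac: "\<And>u. \<exists>a\<in>polys_over A. \<exists>b\<in>polys_over A.
        lin_eval \<eta> M b \<noteq> 0 \<and> u = lin_eval \<eta> M a * inverse (lin_eval \<eta> M b)"
    by (simp_all add: toric_frame_with_def frame_map_eq_lin_eval)
  have "M f * M g = twist (bichar \<Lambda> f g) * M (f + g)" for f g
    using mult[OF single_polys[OF one_mem] single_polys[OF one_mem], of f g]
    by (simp add: qtorus_mult_def lin_eval_single map_one twist_def)
  then interpret quantum_torus_map A \<eta> l \<zeta> \<Lambda> M
    by unfold_locales (use skew one[unfolded lin_eval_single map_one] in auto)
  show "toric_frame_map A \<eta> l \<zeta> \<Lambda> M"
  proof
    show "p = 0" if "p \<in> polys_over A" "lin_eval \<eta> M p = 0" for p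
      using inj_onD[OF inj _ that(1) zero_polys] that(2) by (simp add: lin_eval_zero)
    show "\<exists>a\<in>combs UNIV. \<exists>b\<in>combs UNIV. b \<noteq> 0 \<and> u = a * inverse b" for u
      using frac[of u] by (auto simp: combs_def)
  qed
next
  assume "toric_frame_map A \<eta> l \<zeta> \<Lambda> M"
  then interpret toric_frame_map A \<eta> l \<zeta> \<Lambda> M .
  have "inj_on (lin_eval \<eta> M) (polys_over A)"
  proof (rule inj_onI)
    fix p q assume "p \<in> polys_over A" "q \<in> polys_over A" "lin_eval \<eta> M p = lin_eval \<eta> M q"
    then show "p = q"
      using independent[of "p - q"] by (simp add: diff_polys lin_eval_diff)
  qed
  moreover have "lin_eval \<eta> M (qtorus_mult \<zeta> \<Lambda> a b) = lin_eval \<eta> M a * lin_eval \<eta> M b"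
    if "a \<in> polys_over A" "b \<in> polys_over A" for a b
    unfolding qtorus_mult_eq_twisted_mult using that
    by (intro lin_eval_twisted_mult) (simp_all add: zeta_powi_mem M_mult twist_def)
  moreover have "\<exists>a\<in>polys_over A. \<exists>b\<in>polys_over A.
      lin_eval \<eta> M b \<noteq> 0 \<and> u = lin_eval \<eta> M a * inverse (lin_eval \<eta> M b)" for u
    using fraction[of u] by (auto simp: combs_def)
  ultimately show "toric_frame_with A \<eta> l \<zeta> \<Lambda> M"
    unfolding toric_frame_with_def frame_map_eq_lin_eval lin_eval_single map_one M_0
    by (simp add: skew lin_eval_add)
qed

end

section \<open>Mutation of exchange matrices\<close>

text \<open>Opposite signs cancel and equal signs double the product up to sign, so the halving is
  exact; the case form spares all later computations the \<open>div\<close>.\<close>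

lemma half_sign_sum:
  fixes a b :: int
  shows "(\<bar>a\<bar> * b + a * \<bar>b\<bar>) div 2 =
    (if 0 < a \<and> 0 < b then a * b else if a < 0 \<and> b < 0 then - (a * b) else 0)"
proof -
  have "\<bar>a\<bar> * b + a * \<bar>b\<bar> =
      2 * (if 0 < a \<and> 0 < b then a * b else if a < 0 \<and> b < 0 then - (a * b) else 0)"
    by (auto simp: abs_if)
  then show ?thesis
    by simp
qed

lemma exchange_matrix_pos: "exchange_matrix ex d B \<Longrightarrow> j \<in> ex \<Longrightarrow> 0 < d j"
  unfolding exchange_matrix_def by blast

lemma exchange_matrix_skew:
  "exchange_matrix ex d B \<Longrightarrow> i \<in> ex \<Longrightarrow> j \<in> ex \<Longrightarrow> d i * B $ i $ j = - (d j * B $ j $ i)"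
  unfolding exchange_matrix_def by blast

lemma exchange_matrix_sign:
  assumes "exchange_matrix ex d B" "i \<in> ex" "j \<in> ex"
  shows "0 < B $ i $ j \<longleftrightarrow> B $ j $ i < 0"
proof -
  have "0 < d i * B $ i $ j \<longleftrightarrow> d j * B $ j $ i < 0"
    using exchange_matrix_skew[OF assms] by linarith
  then show ?thesis
    using exchange_matrix_pos[OF assms(1,2)] exchange_matrix_pos[OF assms(1,3)]
    by (simp add: zero_less_mult_iff mult_less_0_iff)
qed

lemma exchange_matrix_diagonal:
  assumes "exchange_matrix ex d B" "k \<in> ex"
  shows "B $ k $ k = 0"
  using exchange_matrix_sign[OF assms(1,2,2)] by linarith

text \<open>The same \<open>d\<close> serves again. Two uses of skew-symmetry carry it across the
  product of the entries along the path from \<open>i\<close> through \<open>k\<close> to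
  \<open>j\<close>; reversing the path flips both signs and so exchanges the two nonzero cases of
  \<open>half_sign_sum\<close>.\<close>

lemma exchange_matrix_mutate:
  assumes B: "exchange_matrix ex d B" and k: "k \<in> ex"
  shows "exchange_matrix ex d (mutate_matrix k B)"
  unfolding exchange_matrix_def
proof (intro conjI ballI)
  show "0 < d j" if "j \<in> ex" for j
    by (rule exchange_matrix_pos[OF B that])
  fix i j assume ij: "i \<in> ex" "j \<in> ex"
  note skew = exchange_matrix_skew[OF B]
  have "d i * (B $ i $ k * B $ k $ j) = - (d k * B $ k $ i * B $ k $ j)"
    using skew[OF ij(1) k] by (simp flip: mult.assoc)
  also have "\<dots> = - (d k * B $ k $ j) * B $ k $ i"
    by simp
  also have "\<dots> = d j * (B $ j $ k * B $ k $ i)"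
    using skew[OF ij(2) k] by (simp flip: mult.assoc)
  finally have "d i * (B $ i $ k * B $ k $ j) = d j * (B $ j $ k * B $ k $ i)" .
  then have "d i * ((\<bar>B $ i $ k\<bar> * B $ k $ j + B $ i $ k * \<bar>B $ k $ j\<bar>) div 2)
      = - (d j * ((\<bar>B $ j $ k\<bar> * B $ k $ i + B $ j $ k * \<bar>B $ k $ i\<bar>) div 2))"
    unfolding half_sign_sum
    using exchange_matrix_sign[OF B ij(1) k] exchange_matrix_sign[OF B ij(2) k]
      exchange_matrix_sign[OF B k ij(1)] exchange_matrix_sign[OF B k ij(2)]
    by auto
  then show "d i * mutate_matrix k B $ i $ j = - (d j * mutate_matrix k B $ j $ i)"
    using skew[OF ij] by (simp add: mutate_matrix_def distrib_left)
qed

section \<open>Mutation of root of unity quantum seeds\<close>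

text \<open>\<open>compatible\<close> reads the matrix condition as a bilinear identity in an
  arbitrary vector, the form to which a base change can be applied.\<close>

locale quantum_seed_map = toric_frame_map A \<eta> l \<zeta> \<Lambda> M
  for A :: "'c::field set" and \<eta> :: "'c \<Rightarrow> 'd::division_ring" and l \<zeta>
    and \<Lambda> :: "int ^ 'n ^ 'n::finite" and M +
  fixes ex :: "'n set" and d :: "'n \<Rightarrow> int" and B :: "int ^ 'n ^ 'n"
  assumes exchange: "exchange_matrix ex d B"
    and coprime_d: "j \<in> ex \<Longrightarrow> coprime (int l) (d j)"
    and compatible: "j \<in> ex \<Longrightarrow> [bichar \<Lambda> (column j B) f = f $ j * d j] (mod int l)"

lemma transpose_mult_entry:
  "(Finite_Cartesian_Product.transpose \<Lambda> ** B) $ i $ j = bichar \<Lambda> (column j B) (axis i 1)"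
  by (simp add: matrix_matrix_mult_def Finite_Cartesian_Product.transpose_def bichar_axis_right column_def mult.commute)

lemma (in root_of_unity_algebra) quantum_seed_iff:
  fixes B :: "int ^ 'n ^ 'n::finite"
  assumes "\<forall>j\<in>ex. coprime (int l) (d j)"
  shows "quantum_seed A \<eta> l \<zeta> ex d M B \<longleftrightarrow> (\<exists>\<Lambda>. quantum_seed_map A \<eta> l \<zeta> \<Lambda> M ex d B)"
proof -
  have "(\<forall>i. \<forall>j\<in>ex. [(Finite_Cartesian_Product.transpose \<Lambda> ** B) $ i $ j = (if i = j then d j else 0)] (mod int l))
      \<longleftrightarrow> (\<forall>j\<in>ex. \<forall>f. [bichar \<Lambda> (column j B) f = f $ j * d j] (mod int l))" (is "?L \<longleftrightarrow> ?R") for \<Lambda> :: "int ^ 'n ^ 'n"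
  proof
    assume L: ?L
    show ?R
    proof (intro ballI allI)
      fix j f assume j: "j \<in> ex"
      have "[bichar \<Lambda> (column j B) f = (\<Sum>i\<in>UNIV. f $ i * (if i = j then d j else 0))] (mod int l)"
        unfolding bichar_expand[of \<Lambda> _ f]
        by (intro cong_sum cong_mult cong_refl) (use L j in \<open>simp add: transpose_mult_entry\<close>)
      then show "[bichar \<Lambda> (column j B) f = f $ j * d j] (mod int l)"
        by (simp add: if_distrib[of "\<lambda>x. _ * x"] cong: if_cong)
    qed
  next
    assume R: ?R
    show ?L
    proof (intro allI ballI)
      fix i j assume "j \<in> ex"
      moreover have "axis i 1 $ j = (if i = j then 1 else (0::int))"
        by (auto simp: axis_def)
      ultimately show "[(Finite_Cartesian_Product.transpose \<Lambda> ** B) $ i $ j = (if i = j then d j else 0)] (mod int l)"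
        using R[rule_format, of j "axis i 1"] by (auto simp: transpose_mult_entry)
    qed
  qed
  then show ?thesis
    using assms
    by (auto simp: quantum_seed_def toric_frame_with_iff quantum_seed_map_def quantum_seed_map_axioms_def)
qed

locale quantum_mutation_step = quantum_seed_map A \<eta> l \<zeta> \<Lambda> M ex d B
  for A :: "'c::field set" and \<eta> :: "'c \<Rightarrow> 'd::division_ring" and l \<zeta>
    and \<Lambda> :: "int ^ 'n ^ 'n::finite" and M ex d B +
  fixes k :: 'n
  assumes k: "k \<in> ex"
begin

definition exp_pos :: "int ^ 'n" where
  "exp_pos = - axis k 1 + pos_part (column k B)"

definition exp_neg :: "int ^ 'n" where
  "exp_neg = - axis k 1 - neg_part (column k B)"

definition new_var :: 'd where
  "new_var = M exp_pos + M exp_neg"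

definition drop_k :: "int ^ 'n \<Rightarrow> int ^ 'n" where
  "drop_k f = (\<chi> i. if i = k then 0 else f $ i)"

text \<open>The linear map that fixes the basis vectors other than the \<open>k\<close>-th and sends
  that one to \<open>exp_pos\<close>. The mutated form is the pullback of \<Lambda> along
  it.\<close>

definition base_change :: "int ^ 'n \<Rightarrow> int ^ 'n" where
  "base_change f = drop_k f + f $ k *s exp_pos"

definition new_form :: "int ^ 'n ^ 'n" where
  "new_form = (\<chi> i j. bichar \<Lambda> (base_change (axis i 1)) (base_change (axis j 1)))"

text \<open>In a quantum torus a monomial of exponent \<open>f + g\<close> is the product of the two
  monomials, corrected by a twist with the negative of their pairing. Splitting \<open>f\<close>
  into \<open>drop_k f\<close> and its \<open>k\<close>-th component forces this value.\<close>

definition new_frame :: "int ^ 'n \<Rightarrow> 'd" where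
  "new_frame f = twist (- (f $ k * bichar \<Lambda> (drop_k f) exp_pos)) * (M (drop_k f) * new_var powi (f $ k))"

lemma diagonal_k: "B $ k $ k = 0"
  by (rule exchange_matrix_diagonal[OF exchange k])

lemma exp_pos_k: "exp_pos $ k = - 1" and exp_neg_k: "exp_neg $ k = - 1"
  by (simp_all add: exp_pos_def exp_neg_def pos_part_def neg_part_def column_def diagonal_k)

lemma exp_neg_eq: "exp_neg = exp_pos - column k B"
  by (simp add: exp_pos_def exp_neg_def pos_part_def neg_part_def vec_eq_iff max_def min_def)

lemma drop_k_add: "drop_k (f + g) = drop_k f + drop_k g"
  and drop_k_k: "drop_k f $ k = 0"
  and drop_k_id: "f $ k = 0 \<Longrightarrow> drop_k f = f"
  and drop_k_decomp: "drop_k f + f $ k *s axis k 1 = f"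
  and drop_k_axis_k: "drop_k (c *s axis k 1) = 0"
  by (auto simp: drop_k_def vec_eq_iff axis_def)

text \<open>The two exponents differ by the \<open>k\<close>-th column, which pairs to 0 with such
  \<open>f\<close>. So both summands of the new variable commute with \<open>M f\<close> up to one
  common factor.\<close>

lemma bichar_exp_neg:
  assumes "f $ k = 0"
  shows "[bichar \<Lambda> exp_neg f = bichar \<Lambda> exp_pos f] (mod int l)"
  using compatible[OF k, of f] assms by (simp add: exp_neg_eq bichar_linear cong_iff_dvd_diff)

lemma new_var_commute:
  assumes "f $ k = 0"
  shows "new_var * M f = twist (2 * bichar \<Lambda> exp_pos f) * (M f * new_var)"
proof -
  have "twist (2 * bichar \<Lambda> exp_neg f) = twist (2 * bichar \<Lambda> exp_pos f)"
    by (intro twist_cong cong_mult cong_refl bichar_exp_neg assms)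
  then show ?thesis
    by (simp add: new_var_def distrib_left distrib_right M_commute[of exp_pos f] M_commute[of exp_neg f])
qed

lemma new_var_nonzero: "new_var \<noteq> 0"
proof
  let ?p = "Poly_Mapping.single exp_pos 1 + Poly_Mapping.single exp_neg (1::'c)"
  assume "new_var = 0"
  then have "lin_eval \<eta> M ?p = 0"
    by (simp add: lin_eval_add single_polys one_mem lin_eval_single map_one new_var_def)
  then have "?p = 0"
    by (intro independent add_polys single_polys one_mem)
  then have "Poly_Mapping.lookup ?p exp_pos = 0"
    by simp
  \<comment> \<open>If the \<open>k\<close>-th column is zero, which compatibility permits only for
    \<open>l = 1\<close>, the exponents coincide and the coefficient is 2; this is where
    \<open>two_nonzero\<close> enters.\<close>
  then show False
    using two_nonzero by (simp add: lookup_add lookup_single when_def split: if_splits)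
qed

lemma powi_commute:
  assumes x: "x \<noteq> 0" and xu: "x * u = twist c * (u * x)"
  shows "x powi n * u = twist (n * c) * (u * x powi n)"
proof -
  have pow: "y ^ m * u = twist (int m * c') * (u * y ^ m)" if "y * u = twist c' * (u * y)" for y c' m
  proof (induction m)
    case (Suc m)
    have "y ^ Suc m * u = y * (y ^ m * u)"
      by (simp add: mult.assoc)
    also have "\<dots> = twist (int m * c') * ((y * u) * y ^ m)"
      by (simp add: Suc twist_left_commute mult.assoc)
    also have "\<dots> = twist (int (Suc m) * c') * (u * y ^ Suc m)"
      by (simp add: that twist_twist mult.assoc distrib_right add.commute)
    finally show ?case .
  qed (simp add: twist_0)
  have "u * inverse x = inverse x * (x * u) * inverse x"
    using x by (simp flip: mult.assoc)
  also have "\<dots> = twist c * (inverse x * u)"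
    using x by (simp add: xu twist_left_commute mult.assoc)
  finally have "inverse x * u = twist (- c) * (u * inverse x)"
    by (simp add: twist_twist twist_0)
  from pow[OF this] pow[OF xu] show ?thesis
    by (cases "n \<ge> 0") (simp_all add: power_int_def)
qed

lemma new_var_powi_commute:
  "f $ k = 0 \<Longrightarrow> new_var powi n * M f = twist (2 * n * bichar \<Lambda> exp_pos f) * (M f * new_var powi n)"
  using powi_commute[OF new_var_nonzero new_var_commute, of f n] by (simp add: mult.left_commute mult.assoc)

lemma new_frame_drop: "f $ k = 0 \<Longrightarrow> new_frame f = M f"
  by (simp add: new_frame_def drop_k_id twist_0)

lemma new_frame_axis_k: "new_frame (c *s axis k 1) = new_var powi c"
  by (simp add: new_frame_def drop_k_axis_k M_0 bichar_linear twist_0)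

lemma new_frame_axis:
  "new_frame (axis i 1) = (if i = k then new_var else M (axis i 1))"
  using new_frame_axis_k[of 1] new_frame_drop[of "axis i 1"] by (simp add: axis_def)

lemma base_change_sum: "base_change f = (\<Sum>i\<in>UNIV. f $ i *s base_change (axis i 1))"
proof -
  have "base_change f $ j = (\<Sum>i\<in>UNIV. f $ i * base_change (axis i 1) $ j)" for j
  proof -
    have "(\<Sum>i\<in>UNIV. f $ i * base_change (axis i 1) $ j)
      = (\<Sum>i\<in>UNIV. (if i = j then drop_k f $ i else 0) + (if i = k then f $ i * exp_pos $ j else 0))"
      by (rule sum.cong) (auto simp: base_change_def drop_k_def axis_def)
    then show ?thesis
      by (simp add: sum.distrib base_change_def)
  qed
  then show ?thesis
    by (simp add: vec_eq_iff)
qed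

lemma bichar_new_form: "bichar new_form f g = bichar \<Lambda> (base_change f) (base_change g)"
proof -
  have "bichar \<Lambda> (base_change f) (base_change g)
      = (\<Sum>i\<in>UNIV. \<Sum>j\<in>UNIV. f $ i * (g $ j * new_form $ i $ j))"
    unfolding base_change_sum[of f] bichar_sum_left bichar_scale_left
    unfolding base_change_sum[of g] bichar_sum_right bichar_scale_right
    by (simp add: new_form_def sum_distrib_left)
  then show ?thesis
    by (simp add: bichar_def[of new_form] mult.commute mult.left_commute)
qed

lemmas twist_shift = twist_left_commute[of "M f" for f] twist_left_commute[of "new_var powi n" for n]

text \<open>A single reordering is needed, of a power of the new variable past
  \<open>M (drop_k g)\<close>. The exponents of the two sides then agree only modulo
  \<open>l\<close>: their difference is made of the diagonal value at \<open>exp_pos\<close> and the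
  skew-symmetry defect \<open>b + c\<close>.\<close>

lemma new_frame_mult:
  "new_frame f * new_frame g = twist (bichar new_form f g) * new_frame (f + g)"
proof -
  let ?h = exp_pos and ?X = new_var and ?f = "drop_k f" and ?g = "drop_k g"
  define a where "a = bichar \<Lambda> ?f ?h"
  define b where "b = bichar \<Lambda> ?g ?h"
  define c where "c = bichar \<Lambda> ?h ?g"
  define e where "e = bichar \<Lambda> ?f ?g"
  let ?U = "M (?f + ?g) * ?X powi (f $ k + g $ k)"
  have "new_frame f * new_frame g
      = twist (- (f $ k * a) + - (g $ k * b)) * (M ?f * (?X powi (f $ k) * M ?g) * ?X powi (g $ k))"
    by (simp add: new_frame_def a_def b_def mult.assoc twist_shift twist_twist add.commute)
  also have "\<dots> = twist (- (f $ k * a) + - (g $ k * b) + 2 * f $ k * c)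
      * (M ?f * M ?g * (?X powi (f $ k) * ?X powi (g $ k)))"
    by (simp add: new_var_powi_commute drop_k_k c_def mult.assoc twist_shift twist_twist add.commute)
  also have "\<dots> = twist (- (f $ k * a) + - (g $ k * b) + 2 * f $ k * c + e) * ?U"
    by (simp add: M_mult e_def power_int_add new_var_nonzero twist_twist mult.assoc)
  finally have L: "new_frame f * new_frame g = \<dots>" .
  have "bichar new_form f g = e + g $ k * a + f $ k * c + f $ k * g $ k * bichar \<Lambda> ?h ?h"
    by (simp add: bichar_new_form base_change_def bichar_linear a_def c_def e_def algebra_simps)
  then have "twist (bichar new_form f g) * new_frame (f + g)
      = twist (e + g $ k * a + f $ k * c + f $ k * g $ k * bichar \<Lambda> ?h ?h
          + - ((f $ k + g $ k) * (a + b))) * ?U"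
    by (simp add: new_frame_def drop_k_add bichar_linear a_def b_def twist_twist)
  also have "twist (e + g $ k * a + f $ k * c + f $ k * g $ k * bichar \<Lambda> ?h ?h
          + - ((f $ k + g $ k) * (a + b))) = twist (- (f $ k * a) + - (g $ k * b) + 2 * f $ k * c + e)"
  proof (rule twist_cong)
    have "int l dvd b + c"
      using bichar_skew[of ?g ?h] by (simp add: b_def c_def cong_iff_dvd_diff)
    moreover have "int l dvd bichar \<Lambda> ?h ?h"
      using bichar_self by (simp add: cong_0_iff)
    ultimately have "int l dvd f $ k * g $ k * bichar \<Lambda> ?h ?h - f $ k * (b + c)"
      by simp
    then show "[e + g $ k * a + f $ k * c + f $ k * g $ k * bichar \<Lambda> ?h ?h + - ((f $ k + g $ k) * (a + b))
        = - (f $ k * a) + - (g $ k * b) + 2 * f $ k * c + e] (mod int l)"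
      by (simp add: cong_iff_dvd_diff algebra_simps)
  qed
  finally show ?thesis
    using L by simp
qed

sublocale mutated: quantum_torus_map A \<eta> l \<zeta> new_form new_frame
proof
  show "skew_mod l new_form"
    unfolding skew_mod_def using bichar_skew by (simp add: new_form_def)
  show "new_frame 0 = 1"
    using new_frame_axis_k[of 0] by simp
qed (rule new_frame_mult)

end

text \<open>A crude uniform bound for a finite support: shifting by the sum of absolute values
  clears all negative exponents.\<close>

lemma coordinate_bound:
  fixes K :: "(int ^ 'n) set"
  assumes "finite K" "f \<in> K"
  shows "0 \<le> f $ k + int (\<Sum>g\<in>K. nat \<bar>g $ k\<bar>)"
proof -
  have "nat \<bar>f $ k\<bar> \<le> (\<Sum>g\<in>K. nat \<bar>g $ k\<bar>)"
    using assms by (intro member_le_sum) auto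
  then show ?thesis by linarith
qed

lemma (in quantum_torus_map) combs_scale: "a \<in> A \<Longrightarrow> u \<in> combs S \<Longrightarrow> \<eta> a * u \<in> combs S"
  using combs_mult[OF combs_monomial[of a 0 "{0}"], of u S S] by (simp add: M_0)

lemma (in quantum_torus_map) combs_subset:
  assumes "u \<in> combs S" "\<And>f. f \<in> S \<Longrightarrow> M f \<in> V" "0 \<in> V"
    and "\<And>v w. v \<in> V \<Longrightarrow> w \<in> V \<Longrightarrow> v + w \<in> V" "\<And>a v. a \<in> A \<Longrightarrow> v \<in> V \<Longrightarrow> \<eta> a * v \<in> V"
  shows "u \<in> V"
proof -
  obtain p where p: "p \<in> polys_over A" "Poly_Mapping.keys p \<subseteq> S" "u = lin_eval \<eta> M p"
    using assms(1) by (auto simp: combs_def)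
  have "(\<Sum>f\<in>K. \<eta> (Poly_Mapping.lookup p f) * M f) \<in> V" if "finite K" "K \<subseteq> S" for K
    using that by (induction K) (use assms(2-) lookup_polys_over[OF p(1)] in auto)
  then show ?thesis
    using p(2) by (simp add: p(3) lin_eval_def)
qed

section \<open>Independence of the mutated frame and generation of the division ring by it\<close>

context quantum_mutation_step
begin

lemma new_frame_powi: "new_frame f * new_var ^ r
    = twist (- (f $ k * bichar \<Lambda> (drop_k f) exp_pos)) * (M (drop_k f) * new_var powi (f $ k + int r))"
  by (simp add: new_frame_def power_int_add new_var_nonzero mult.assoc)

lemma new_var_power_combs: "new_var ^ n \<in> combs {f. f $ k = - int n}"
proof (induction n)
  case 0
  then show ?case using combs_M[of 0] by (simp add: M_0)
next
  case (Suc n)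
  have "new_var \<in> combs {f. f $ k = - 1}"
    unfolding new_var_def by (intro combs_add combs_M) (simp_all add: exp_pos_k exp_neg_k)
  then show ?case
    unfolding power_Suc using Suc by (rule combs_mult) simp
qed

lemma drop_k_inj: "inj_on drop_k {f. f $ k = t}"
  by (rule inj_onI) (metis (mono_tags, lifting) drop_k_decomp mem_Collect_eq)

text \<open>
  After right multiplication by a power of the new variable only nonnegative powers of it remain, so
  that the relation lives in the old torus, where it splits according to the \<open>k\<close>-th coordinate.
\<close>

lemma new_frame_independent:
  assumes p: "p \<in> polys_over A" and 0: "lin_eval \<eta> new_frame p = 0"
  shows "p = 0"
proof -
  let ?K = "Poly_Mapping.keys p"
  define r where "r = (\<Sum>f\<in>?K. nat \<bar>f $ k\<bar>)"
  define c where "c f = Poly_Mapping.lookup p f * \<zeta> powi (- (f $ k * bichar \<Lambda> (drop_k f) exp_pos))" for f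
  define w where "w t = (\<Sum>f\<in>{f \<in> ?K. f $ k = t}. \<eta> (c f) * M (drop_k f))" for t
  have cA: "c f \<in> A" for f
    unfolding c_def by (intro mult_mem lookup_polys_over p zeta_powi_mem)
  have r: "0 \<le> f $ k + int r" if "f \<in> ?K" for f
    unfolding r_def using that by (intro coordinate_bound) simp_all
  have "0 = lin_eval \<eta> new_frame p * new_var ^ r"
    using 0 by simp
  also have "\<dots> = (\<Sum>f\<in>?K. \<eta> (c f) * M (drop_k f) * new_var powi (f $ k + int r))"
    unfolding lin_eval_def sum_distrib_right mult.assoc new_frame_powi c_def twist_def
    by (simp add: map_mult lookup_polys_over p zeta_powi_mem mult.assoc)
  also have "\<dots> = (\<Sum>t\<in>(\<lambda>f. f $ k) ` ?K. \<Sum>f\<in>{f \<in> ?K. f $ k = t}.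
      \<eta> (c f) * M (drop_k f) * new_var powi (f $ k + int r))"
    by (rule sum.image_gen) simp
  also have "\<dots> = (\<Sum>t\<in>(\<lambda>f. f $ k) ` ?K. w t * new_var powi (t + int r))"
    unfolding w_def sum_distrib_right by (intro sum.cong) auto
  finally have sum0: "(\<Sum>t\<in>(\<lambda>f. f $ k) ` ?K. w t * new_var powi (t + int r)) = 0"
    by simp
  have w0: "w t = 0" if t: "t \<in> (\<lambda>f. f $ k) ` ?K" for t
  proof -
    \<comment> \<open>\<open>w t\<close> has height 0 and the power of the new variable has height
      \<open>- (t + int r)\<close>, so different \<open>t\<close> lie in different graded
      pieces.\<close>
    have "w t * new_var powi (t + int r) = 0"
    proof (rule graded_independent[where T = "(\<lambda>f. f $ k) ` ?K" and k = k
        and ht = "\<lambda>t. - (t + int r)" and u = "\<lambda>t. w t * new_var powi (t + int r)"])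
      fix t assume "t \<in> (\<lambda>f. f $ k) ` ?K"
      then have "t + int r = int (nat (t + int r))"
        using r by auto
      then have X: "new_var powi (t + int r) \<in> combs {f. f $ k = - (t + int r)}"
        using new_var_power_combs[of "nat (t + int r)"] by (metis power_int_of_nat)
      have "w t \<in> combs {f. f $ k = 0}"
        unfolding w_def by (intro combs_sum combs_monomial cA) (simp add: drop_k_k)
      from this X show "w t * new_var powi (t + int r) \<in> combs {f. f $ k = - (t + int r)}"
        by (rule combs_mult) simp
    qed (use sum0 t in \<open>simp_all add: inj_on_def\<close>)
    then show ?thesis
      by (simp add: new_var_nonzero)
  qed
  \<comment> \<open>On a fixed level of the \<open>k\<close>-th coordinate \<open>drop_k\<close> is
    injective, so the vanishing of \<open>w\<close> there is a relation between distinct old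
    monomials.\<close>
  have "Poly_Mapping.lookup p f = 0" for f
  proof (rule ccontr)
    assume f: "Poly_Mapping.lookup p f \<noteq> 0"
    let ?S = "{g \<in> ?K. g $ k = f $ k}"
    have inj: "inj_on drop_k ?S"
      by (rule inj_on_subset[OF drop_k_inj]) auto
    have "lin_eval \<eta> M (\<Sum>g\<in>?S. Poly_Mapping.single (drop_k g) (c g)) = w (f $ k)"
      by (simp add: lin_eval_sum_single cA w_def)
    then have "(\<Sum>g\<in>?S. Poly_Mapping.single (drop_k g) (c g)) = 0"
      using f by (intro independent sum_polys single_polys cA) (auto simp: w0 in_keys_iff)
    then have "c f = 0"
      using lookup_sum_single_inj[OF _ inj, of f c] f by (simp add: in_keys_iff)
    then show False
      using f zeta_nonzero by (simp add: c_def)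
  qed
  then show ?thesis
    by (intro poly_mapping_eqI) simp
qed

text \<open>In \<open>M (axis k 1) * new_var\<close> both terms have \<open>k\<close>-th coordinate
  0 and hence lie in the new torus; dividing by the new variable puts \<open>M (axis k 1)\<close>
  there. Its inverse need not lie there, whence the restriction to a half-space.\<close>

lemma combs_nonneg_subset: "combs {f. 0 \<le> f $ k} \<subseteq> mutated.combs UNIV"
proof
  have low: "M f \<in> mutated.combs UNIV" if "f $ k = 0" for f
    using mutated.combs_M[of f UNIV] by (simp add: new_frame_drop that)
  define s where "s = M (axis k 1) * new_var"
  have "s \<in> mutated.combs UNIV"
    unfolding s_def new_var_def distrib_left M_mult twist_def
    by (intro mutated.combs_add mutated.combs_scale zeta_powi_mem low)
      (simp_all add: exp_pos_k exp_neg_k)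
  moreover have "inverse new_var \<in> mutated.combs UNIV"
    using mutated.combs_M[of "- 1 *s axis k 1" UNIV] by (simp add: new_frame_axis_k power_int_minus)
  ultimately have "s * inverse new_var \<in> mutated.combs UNIV"
    by (rule mutated.combs_mult) simp
  moreover have "s * inverse new_var = M (axis k 1)"
    by (simp add: s_def mult.assoc new_var_nonzero)
  ultimately have axis: "M (axis k 1) \<in> mutated.combs UNIV"
    by simp
  fix u assume "u \<in> combs {f. 0 \<le> f $ k}"
  then show "u \<in> mutated.combs UNIV"
  proof (rule combs_subset)
    fix f :: "int ^ 'n" assume "f \<in> {f. 0 \<le> f $ k}"
    then have "M (f $ k *s axis k 1) = M (axis k 1) ^ nat (f $ k)"
      by (simp add: M_power)
    then have "M (f $ k *s axis k 1) \<in> mutated.combs UNIV"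
      by (simp add: mutated.combs_power[OF axis])
    with low[OF drop_k_k] have "M (drop_k f) * M (f $ k *s axis k 1) \<in> mutated.combs UNIV"
      by (rule mutated.combs_mult) simp
    then have "M (drop_k f + f $ k *s axis k 1) \<in> mutated.combs UNIV"
      unfolding M_add by (rule mutated.combs_twist)
    then show "M f \<in> mutated.combs UNIV"
      by (simp add: drop_k_decomp)
  qed (auto intro: mutated.combs_zero mutated.combs_add mutated.combs_scale)
qed

text \<open>Valid for all large shifts, so that numerator and denominator of a fraction can be
  multiplied by the same monomial.\<close>

lemma combs_shift_nonneg:
  assumes "u \<in> combs UNIV"
  shows "\<exists>r. \<forall>s\<ge>r. u * M (int s *s axis k 1) \<in> combs {f. 0 \<le> f $ k}"
proof -
  obtain p where p: "p \<in> polys_over A" "u = lin_eval \<eta> M p"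
    using assms by (auto simp: combs_def)
  let ?K = "Poly_Mapping.keys p"
  define r where "r = (\<Sum>f\<in>?K. nat \<bar>f $ k\<bar>)"
  have r: "0 \<le> f $ k + int r" if "f \<in> ?K" for f
    unfolding r_def using that by (intro coordinate_bound) simp_all
  have "u * M (int s *s axis k 1) \<in> combs {f. 0 \<le> f $ k}" if "r \<le> s" for s
  proof (rule combs_mult)
    show "u \<in> combs ?K"
      unfolding p(2) by (rule combsI[OF p(1)]) simp
    show "M (int s *s axis k 1) \<in> combs {int s *s axis k 1}"
      by (rule combs_M) simp
  qed (use r that in force)
  then show ?thesis by blast
qed

lemma new_frame_fraction:
  "\<exists>a\<in>mutated.combs UNIV. \<exists>b\<in>mutated.combs UNIV. b \<noteq> 0 \<and> u = a * inverse b"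
proof -
  obtain a b where ab: "a \<in> combs UNIV" "b \<in> combs UNIV" "b \<noteq> 0" "u = a * inverse b"
    using fraction by blast
  obtain r r' where r: "\<And>s. r \<le> s \<Longrightarrow> a * M (int s *s axis k 1) \<in> combs {f. 0 \<le> f $ k}"
    and r': "\<And>s. r' \<le> s \<Longrightarrow> b * M (int s *s axis k 1) \<in> combs {f. 0 \<le> f $ k}"
    using combs_shift_nonneg ab by meson
  define m where "m = M (int (max r r') *s axis k 1)"
  have "a * m \<in> mutated.combs UNIV" "b * m \<in> mutated.combs UNIV"
    unfolding m_def by (intro subsetD[OF combs_nonneg_subset] r r'; simp)+
  moreover have "u = (a * m) * inverse (b * m)"
  proof -
    have "(a * m) * inverse (b * m) = a * (m * inverse m) * inverse b"
      using ab(3) M_nonzero by (simp only: nonzero_inverse_mult_distrib m_def mult.assoc not_False_eq_True)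
    then show ?thesis
      by (simp add: ab(4) m_def M_nonzero)
  qed
  moreover have "b * m \<noteq> 0"
    using ab(3) by (simp add: m_def M_nonzero)
  ultimately show ?thesis by blast
qed

text \<open>Base change turns the mutated columns into combinations of old ones, so that the old
  compatibility evaluates the new form.\<close>

lemma column_mutate:
  "base_change (column j (mutate_matrix k B))
    = (if j = k then - column k B else column j B + max (- (B $ k $ j)) 0 *s column k B)"
  unfolding vec_eq_iff
proof
  fix i
  show "base_change (column j (mutate_matrix k B)) $ i
    = (if j = k then - column k B else column j B + max (- (B $ k $ j)) 0 *s column k B) $ i"
    by (cases "j = k"; cases "i = k")
      (simp_all add: base_change_def drop_k_def column_def mutate_matrix_def diagonal_k exp_pos_k half_sign_sum,
       auto simp: exp_pos_def pos_part_def column_def axis_def max_def)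
qed

lemma base_change_coord:
  "base_change f $ j = (if j = k then - (f $ k) else f $ j + f $ k * max (B $ j $ k) 0)"
  by (simp add: base_change_def drop_k_def exp_pos_k) (simp add: exp_pos_def pos_part_def column_def axis_def)

text \<open>For \<open>j = k\<close> the column and the coordinate both change sign. Otherwise base
  change adds a multiple of \<open>f $ k\<close> from the coordinate and one from the added column;
  they cancel because \<open>d\<close> skew-symmetrizes \<open>B\<close>.\<close>

lemma new_form_compatible:
  assumes j: "j \<in> ex"
  shows "[bichar new_form (column j (mutate_matrix k B)) f = f $ j * d j] (mod int l)"
proof (cases "j = k")
  case True
  have "[- bichar \<Lambda> (column k B) (base_change f) = - (base_change f $ k * d k)] (mod int l)"
    using compatible[OF k, of "base_change f"] by (simp only: cong_minus_minus_iff)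
  then show ?thesis
    using True by (simp add: bichar_new_form column_mutate bichar_linear base_change_coord)
next
  case False
  let ?m = "max (- (B $ k $ j)) 0"
  have "max (B $ j $ k) 0 * d j = ?m * d k"
  proof -
    have "d j * B $ j $ k = - (d k * B $ k $ j)" "0 < d j" "0 < d k"
      by (intro exchange_matrix_skew[OF exchange] exchange_matrix_pos[OF exchange] j k)+
    then show ?thesis
      using exchange_matrix_sign[OF exchange j k] by (auto simp: max_def mult.commute)
  qed
  then have "base_change f $ j * d j + ?m * (base_change f $ k * d k) = f $ j * d j"
    using False by (simp add: base_change_coord algebra_simps)
  moreover have "[bichar \<Lambda> (column j B) (base_change f) + ?m * bichar \<Lambda> (column k B) (base_change f)
      = base_change f $ j * d j + ?m * (base_change f $ k * d k)] (mod int l)"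
    by (intro cong_add cong_mult cong_refl compatible j k)
  ultimately show ?thesis
    using False by (simp add: bichar_new_form column_mutate bichar_linear)
qed

sublocale mutated: quantum_seed_map A \<eta> l \<zeta> new_form new_frame ex d "mutate_matrix k B"
  by unfold_locales
    (fact new_frame_independent new_frame_fraction exchange_matrix_mutate[OF exchange k] coprime_d
      new_form_compatible)+

lemma new_var_power_l: "new_var ^ l = M (int l *s exp_pos) + M (int l *s exp_neg)"
proof -
  \<comment> \<open>\<open>exp_neg\<close> is \<open>exp_pos\<close> minus the column. The diagonal
    term vanishes, and the sign is positive because \<open>exp_pos\<close> has \<open>k\<close>-th
    coordinate -1.\<close>
  have "[bichar \<Lambda> exp_neg exp_pos = d k] (mod int l)"
  proof -
    have "[bichar \<Lambda> exp_pos exp_pos - bichar \<Lambda> (column k B) exp_pos = 0 - exp_pos $ k * d k] (mod int l)"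
      by (intro cong_diff bichar_self compatible k)
    then show ?thesis
      by (simp add: exp_neg_eq bichar_linear exp_pos_k)
  qed
  then have "coprime (bichar \<Lambda> exp_neg exp_pos) (int l)"
    using coprime_d[OF k] cong_imp_coprime[OF cong_sym] by (metis coprime_commute)
  then have "coprime (2 * bichar \<Lambda> exp_neg exp_pos) (int l)"
    using odd_l by simp
  then show ?thesis
    unfolding new_var_def M_power[symmetric] using M_commute by (rule power_add_root_of_unity)
qed

text \<open>The commutation relations determine the form of a mutated frame modulo \<open>l\<close>, as \<open>l\<close> is odd.\<close>

lemma frame_unique:
  assumes "toric_frame_map A \<eta> l \<zeta> \<Lambda>' M'" and M': "\<And>i. M' (axis i 1) = new_frame (axis i 1)"
  shows "quantum_seed_map A \<eta> l \<zeta> \<Lambda>' M' ex d (mutate_matrix k B)"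
proof -
  interpret new: toric_frame_map A \<eta> l \<zeta> \<Lambda>' M'
    by fact
  have cong: "[\<Lambda>' $ i $ j = new_form $ i $ j] (mod int l)" for i j
  proof -
    have "twist (2 * \<Lambda>' $ i $ j) * (M' (axis j 1) * M' (axis i 1)) = M' (axis i 1) * M' (axis j 1)"
      using new.M_commute[of "axis i 1" "axis j 1"] by (simp only: bichar_axis)
    also have "\<dots> = twist (2 * new_form $ i $ j) * (M' (axis j 1) * M' (axis i 1))"
      using mutated.M_commute[of "axis i 1" "axis j 1"] by (simp only: bichar_axis M')
    finally have "twist (2 * \<Lambda>' $ i $ j) = twist (2 * new_form $ i $ j)"
      using new.M_nonzero[of "axis j 1"] new.M_nonzero[of "axis i 1"]
      by (simp only: mult_cancel_right mult_eq_0_iff simp_thms)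
    then have "[2 * \<Lambda>' $ i $ j = 2 * new_form $ i $ j] (mod int l)"
      by (simp only: twist_eq_iff)
    then show ?thesis
      using odd_l by (simp add: cong_mult_lcancel)
  qed
  have form: "[bichar \<Lambda>' f g = bichar new_form f g] (mod int l)" for f g
    unfolding bichar_def by (intro cong_sum cong_mult cong_refl cong)
  show ?thesis
  proof
    fix j f assume "j \<in> ex"
    then show "[bichar \<Lambda>' (column j (mutate_matrix k B)) f = f $ j * d j] (mod int l)"
      by (rule cong_trans[OF form new_form_compatible])
  qed (fact exchange_matrix_mutate[OF exchange k] coprime_d)+
qed

end

section \<open>Partial isomorphisms between division rings\<close>

text \<open>The graph of an isomorphism between division subrings. Differences together with
  \<open>G_zero_iff\<close> make it single-valued in both directions, and the axioms are symmetric,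
  so each transport result also holds for the converse. Since \<open>inverse 0 = 0\<close>, inverses
  need no exception.\<close>

locale partial_iso =
  fixes G :: "('r::division_ring \<times> 's::division_ring) set"
  assumes G_one: "(1, 1) \<in> G"
    and G_diff: "(u, v) \<in> G \<Longrightarrow> (u', v') \<in> G \<Longrightarrow> (u - u', v - v') \<in> G"
    and G_mult: "(u, v) \<in> G \<Longrightarrow> (u', v') \<in> G \<Longrightarrow> (u * u', v * v') \<in> G"
    and G_inverse: "(u, v) \<in> G \<Longrightarrow> (inverse u, inverse v) \<in> G"
    and G_zero_iff: "(u, v) \<in> G \<Longrightarrow> u = 0 \<longleftrightarrow> v = 0"
begin

lemma G_add: "(u, v) \<in> G \<Longrightarrow> (u', v') \<in> G \<Longrightarrow> (u + u', v + v') \<in> G"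
  using G_diff[of u v "0 - u'" "0 - v'"] G_diff[OF G_diff[OF G_one G_one], of u' v'] by simp

lemma G_power: "(u, v) \<in> G \<Longrightarrow> (u ^ n, v ^ n) \<in> G"
  by (induction n) (auto intro: G_one G_mult)

lemma functional: "(u, v) \<in> G \<Longrightarrow> (u, v') \<in> G \<Longrightarrow> v = v'"
  using G_diff[of u v u v'] G_zero_iff[of 0 "v - v'"] by simp

lemma converse: "partial_iso (G\<inverse>)"
  by unfold_locales (auto intro: G_one G_diff G_mult G_inverse simp: G_zero_iff)

lemma mixed_torus_forward:
  assumes R: "\<And>a. a \<in> R \<Longrightarrow> (\<eta> a, \<sigma> a) \<in> G" and u: "\<And>i. (u i, x i) \<in> G"
    and a: "a \<in> mixed_torus (\<eta> ` R) u I"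
  shows "\<exists>b\<in>mixed_torus (\<sigma> ` R) x I. (a, b) \<in> G"
  using a unfolding mixed_torus_def
proof (induction rule: ring_adjoin.induct)
  case (base r)
  then show ?case using R by (blast intro: ring_adjoin.base)
next
  case (gen s)
  then show ?case using u G_inverse[OF u] by (blast intro: ring_adjoin.gen)
next
  case one
  then show ?case using G_one by (blast intro: ring_adjoin.one)
next
  case (diff u v)
  then show ?case by (meson G_diff ring_adjoin.diff)
next
  case (mult u v)
  then show ?case by (meson G_mult ring_adjoin.mult)
qed

end

context partial_iso
begin

lemma injective: "(u, v) \<in> G \<Longrightarrow> (u', v) \<in> G \<Longrightarrow> u = u'"
  using partial_iso.functional[OF converse] by auto

lemma mixed_torus_backward:
  assumes R: "\<And>a. a \<in> R \<Longrightarrow> (\<eta> a, \<sigma> a) \<in> G" and u: "\<And>i. (u i, x i) \<in> G"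
    and b: "b \<in> mixed_torus (\<sigma> ` R) x I"
  shows "\<exists>a\<in>mixed_torus (\<eta> ` R) u I. (a, b) \<in> G"
  using partial_iso.mixed_torus_forward[OF converse, of R \<sigma> \<eta> x u b I] R u b by auto

text \<open>Matching generators transport membership torus by torus. The tori need not correspond
  bijectively: the partner of an element is unique in \<open>G\<close>, hence the same for all of
  them.\<close>

lemma algebra_isomorphic_Inter:
  assumes R: "\<And>a. a \<in> R \<Longrightarrow> (\<eta> a, \<sigma> a) \<in> G"
    and PQ: "\<And>u. u \<in> P \<Longrightarrow> \<exists>x\<in>Q. \<forall>i. (u i, x i) \<in> G"
    and QP: "\<And>x. x \<in> Q \<Longrightarrow> \<exists>u\<in>P. \<forall>i. (u i, x i) \<in> G"
    and "P \<noteq> {}"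
  shows "algebra_isomorphic R \<eta> \<sigma> (\<Inter>u\<in>P. mixed_torus (\<eta> ` R) u I) (\<Inter>x\<in>Q. mixed_torus (\<sigma> ` R) x I)"
    (is "algebra_isomorphic _ _ _ ?S ?T")
proof -
  define \<phi> where "\<phi> u = (THE v. (u, v) \<in> G)" for u
  have \<phi>: "\<phi> u = v" if "(u, v) \<in> G" for u v
    unfolding \<phi>_def by (rule the_equality, rule that, erule functional[OF _ that])
  have ST: "\<exists>v\<in>?T. (u, v) \<in> G" if u: "u \<in> ?S" for u
  proof -
    have ex: "\<exists>v\<in>mixed_torus (\<sigma> ` R) x I. (u, v) \<in> G" if "x \<in> Q" for x
    proof -
      obtain w where w: "w \<in> P" "\<And>i. (w i, x i) \<in> G"
        using QP[OF \<open>x \<in> Q\<close>] by blast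
      with u have "u \<in> mixed_torus (\<eta> ` R) w I"
        by blast
      with R w(2) show ?thesis
        by (rule mixed_torus_forward)
    qed
    \<comment> \<open>One torus is needed to produce a partner at all; functionality then places it
      in every other torus.\<close>
    obtain x where "x \<in> Q"
      using assms(4) PQ by blast
    then obtain v where "(u, v) \<in> G"
      using ex by blast
    then have "v \<in> ?T"
      using ex functional by (metis INT_I)
    with \<open>(u, v) \<in> G\<close> show ?thesis
      by blast
  qed
  have TS: "\<exists>u\<in>?S. (u, v) \<in> G" if v: "v \<in> ?T" for v
  proof -
    have ex: "\<exists>u\<in>mixed_torus (\<eta> ` R) w I. (u, v) \<in> G" if "w \<in> P" for w
    proof -
      obtain x where x: "x \<in> Q" "\<And>i. (w i, x i) \<in> G"
        using PQ[OF \<open>w \<in> P\<close>] by blast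
      with v have "v \<in> mixed_torus (\<sigma> ` R) x I"
        by blast
      with R x(2) show ?thesis
        by (rule mixed_torus_backward)
    qed
    obtain w where "w \<in> P"
      using assms(4) by blast
    then obtain u where "(u, v) \<in> G"
      using ex by blast
    then have "u \<in> ?S"
      using ex injective by (metis INT_I)
    with \<open>(u, v) \<in> G\<close> show ?thesis
      by blast
  qed
  have \<phi>G: "(u, \<phi> u) \<in> G" if "u \<in> ?S" for u
    using ST[OF that] \<phi> by blast
  have "bij_betw \<phi> ?S ?T"
    unfolding bij_betw_def
  proof
    show "inj_on \<phi> ?S"
      by (rule inj_onI) (metis \<phi>G injective)
    show "\<phi> ` ?S = ?T"
      using ST TS \<phi> by (fastforce simp: image_iff)
  qed
  moreover have "\<phi> (u + v) = \<phi> u + \<phi> v \<and> \<phi> (u * v) = \<phi> u * \<phi> v"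
    if "u \<in> ?S" "v \<in> ?S" for u v
    using that by (intro conjI \<phi> G_add G_mult \<phi>G)
  moreover have "\<phi> (\<eta> a * u) = \<sigma> a * \<phi> u" if "a \<in> R" "u \<in> ?S" for a u
    using that by (intro \<phi> G_mult \<phi>G R)
  moreover have "\<phi> 1 = 1"
    by (rule \<phi>[OF G_one])
  ultimately show ?thesis
    unfolding algebra_isomorphic_def algebra_iso_def by (intro exI[of _ \<phi>] conjI ballI) simp_all
qed

end

section \<open>Comparison with the classical seed\<close>

context quantum_torus_map
begin

text \<open>Exponents divisible by \<open>l\<close> pair to 0 modulo \<open>l\<close>, so products
  with them carry no twist.\<close>

lemma M_l_mult: "M (int l *s f) * M g = M (int l *s f + g)"
  using twist_cong[of "bichar \<Lambda> (int l *s f) g" 0] by (simp add: M_mult bichar_linear cong_0_iff twist_0)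

lemma M_axis_power: "M (int l *s (int n *s axis i 1)) = (M (axis i 1) ^ l) ^ n"
  by (simp add: M_power vector_smult_assoc mult.commute flip: power_mult)

text \<open>Adds one coordinate at a time; by \<open>M_l_mult\<close> the monomial is an ordinary
  product of \<open>l\<close>-th powers. Nonnegativity matches the natural exponents of the
  classical monomial.\<close>

lemma power_monomial_match:
  assumes "partial_iso G" and x: "\<And>i. (M (axis i 1) ^ l, x i) \<in> G" and f: "\<And>i. 0 \<le> f $ i"
  shows "(M (int l *s f), \<Prod>i\<in>UNIV. x i ^ nat (f $ i)) \<in> G"
proof -
  interpret partial_iso G by fact
  have "(M (int l *s (\<Sum>i\<in>S. f $ i *s axis i 1)), \<Prod>i\<in>S. x i ^ nat (f $ i)) \<in> G" if "finite S" for S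
    using that
  proof (induction S)
    case empty
    then show ?case by (simp add: M_0 G_one)
  next
    case (insert i S)
    have "M (int l *s (f $ i *s axis i 1)) = (M (axis i 1) ^ l) ^ nat (f $ i)"
      using M_axis_power[of "nat (f $ i)" i] f by simp
    then have "(M (int l *s (f $ i *s axis i 1)), x i ^ nat (f $ i)) \<in> G"
      by (simp add: G_power x)
    from G_mult[OF this insert.IH] show ?case
      using insert.hyps by (simp add: M_l_mult vector_add_ldistrib)
  qed
  from this[of UNIV] show ?thesis
    by (simp add: basis_expansion)
qed

end

context quantum_mutation_step
begin

text \<open>The existence half: the implicitly defined mutation is always realised, which is what
  lifting classical mutation sequences requires.\<close>

lemma quantum_mutation_new_frame:
  "quantum_mutation A \<eta> l \<zeta> k (M, B) (new_frame, mutate_matrix k B)"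
  using mutated.toric_frame_map_axioms
  by (auto simp: quantum_mutation_def toric_frame_def toric_frame_with_iff new_frame_axis new_var_def
      exp_pos_def exp_neg_def)

lemma quantum_mutation_cases:
  assumes "quantum_mutation A \<eta> l \<zeta> k (M, B) (M', B')"
  obtains \<Lambda>' where "quantum_seed_map A \<eta> l \<zeta> \<Lambda>' M' ex d B'" "B' = mutate_matrix k B"
    "\<And>i. M' (axis i 1) = new_frame (axis i 1)"
proof -
  from assms have "toric_frame A \<eta> l \<zeta> M'" and B': "B' = mutate_matrix k B"
    and M': "M' (axis i 1) = new_frame (axis i 1)" for i
    by (auto simp: quantum_mutation_def new_frame_axis new_var_def exp_pos_def exp_neg_def)
  then obtain \<Lambda>' where "toric_frame_map A \<eta> l \<zeta> \<Lambda>' M'"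
    by (auto simp: toric_frame_def toric_frame_with_iff)
  from that[OF frame_unique[OF this M', folded B'] B' M'] show thesis .
qed

text \<open>Taking the inverse of \<open>M (axis k 1) ^ l\<close> out of both terms of
  \<open>new_var_power_l\<close> leaves the classical exchange numerator over the old
  variable.\<close>

lemma new_var_match:
  assumes "partial_iso G" and x: "\<And>i. (M (axis i 1) ^ l, x i) \<in> G"
  shows "(new_frame (axis i 1) ^ l, fst (mutate_seed k (x, B)) i) \<in> G"
proof (cases "i = k")
  case True
  interpret partial_iso G by fact
  let ?b = "column k B"
  have pos: "(M (int l *s pos_part ?b), \<Prod>i | B $ i $ k > 0. x i ^ nat (B $ i $ k)) \<in> G"
  proof -
    have "(\<Prod>i\<in>UNIV. x i ^ nat (pos_part ?b $ i)) = (\<Prod>i | B $ i $ k > 0. x i ^ nat (B $ i $ k))"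
      by (rule prod.mono_neutral_cong_right) (auto simp: pos_part_def column_def)
    then show ?thesis
      using power_monomial_match[OF assms, of "pos_part ?b"] by (simp add: pos_part_def)
  qed
  have neg: "(M (int l *s - neg_part ?b), \<Prod>i | B $ i $ k < 0. x i ^ nat (- (B $ i $ k))) \<in> G"
  proof -
    have "(\<Prod>i\<in>UNIV. x i ^ nat (- (neg_part ?b) $ i)) = (\<Prod>i | B $ i $ k < 0. x i ^ nat (- (B $ i $ k)))"
      by (rule prod.mono_neutral_cong_right) (auto simp: neg_part_def column_def)
    then show ?thesis
      using power_monomial_match[OF assms, of "- neg_part ?b"] by (simp add: neg_part_def)
  qed
  have "int l *s axis k 1 + int l *s - axis k (1::int) = 0"
    by (simp add: vec_eq_iff)
  then have inv: "M (int l *s - axis k 1) = inverse (M (axis k 1) ^ l)"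
    by (intro inverse_unique[symmetric]) (simp only: M_power M_l_mult M_0)
  have split: "M (int l *s (- axis k 1 + c)) = M (int l *s c) * inverse (M (axis k 1) ^ l)" for c
    by (simp only: vector_add_ldistrib M_l_mult add.commute flip: inv)
  have "new_var ^ l = (M (int l *s pos_part ?b) + M (int l *s - neg_part ?b)) * inverse (M (axis k 1) ^ l)"
    by (simp only: new_var_power_l exp_pos_def exp_neg_def diff_conv_add_uminus split distrib_right)
  then show ?thesis
    using G_mult[OF G_add[OF pos neg] G_inverse[OF x]] True
    by (simp add: new_frame_axis mutate_seed_def divide_inverse)
next
  case False
  then show ?thesis
    using x by (simp add: new_frame_axis mutate_seed_def)
qed

end

context toric_frame_map
begin

lemma lth_power_mult:
  "M (int l *s f) * M (int l *s g) = M (int l *s (f + g))"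
  by (simp add: M_l_mult vector_add_ldistrib)

text \<open>
  The map sending \<open>M(e\<^sub>i)\<^sup>l\<close> to \<open>x\<^sub>i\<close>, extended to fractions of polynomials over the coefficient ring
  \<open>R\<close>.  It is constructed as a relation since it is only defined on a commutative part of the
  division ring.
\<close>

lemma matching_exists:
  fixes \<sigma> :: "'c \<Rightarrow> 'f::field" and x :: "'n \<Rightarrow> 'f"
  assumes R: "subring_algebra R \<eta>" "subring_algebra R \<sigma>" "R \<subseteq> A"
    and indep: "\<And>p. p \<in> polys_over R \<Longrightarrow> poly_eval \<sigma> x p = 0 \<Longrightarrow> p = 0"
  shows "\<exists>G. partial_iso G \<and> (\<forall>a\<in>R. (\<eta> a, \<sigma> a) \<in> G) \<and> (\<forall>i. (M (axis i 1) ^ l, x i) \<in> G)"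
proof -
  interpret q: subring_algebra R \<eta> by fact
  interpret c: subring_algebra R \<sigma> by fact
  define N where "N m = M (int l *s (\<chi> i. int (m $ i)))" for m :: "nat ^ 'n"
  define Y where "Y m = (\<Prod>i\<in>UNIV. x i ^ (m $ i))" for m :: "nat ^ 'n"
  let ?F = "lin_eval \<eta> N" and ?E = "lin_eval \<sigma> Y"
  have N_mult: "N m * N n = N (m + n)" for m n
  proof -
    have "(\<chi> i. int ((m + n) $ i)) = (\<chi> i. int (m $ i)) + (\<chi> i. int (n $ i))"
      by (simp add: vec_eq_iff)
    then show ?thesis
      by (simp add: N_def lth_power_mult)
  qed
  have Y_mult: "Y m * Y n = Y (m + n)" for m n
    by (simp add: Y_def power_add prod.distrib)
  have N_0: "N 0 = 1"
    by (simp add: N_def M_0 flip: zero_vec_def)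
  have Y_0: "Y 0 = 1"
    by (simp add: Y_def)
  have E_0: "p = 0" if "p \<in> polys_over R" "?E p = 0" for p
    using indep[OF that(1)] that(2) unfolding poly_eval_eq_lin_eval Y_def by simp
  \<comment> \<open>Multiplying exponents by the positive number \<open>l\<close> is injective, so a
    relation between \<open>l\<close>-th powers is one between distinct frame elements.\<close>
  have F_0: "p = 0" if p: "p \<in> polys_over R" "?F p = 0" for p
  proof -
    let ?g = "\<lambda>m::nat ^ 'n. int l *s (\<chi> i. int (m $ i))" and ?c = "Poly_Mapping.lookup p"
    have inj: "inj ?g"
      using l_pos by (auto simp: inj_on_def vec_eq_iff)
    have cA: "?c m \<in> A" for m
      using lookup_polys_over[OF p(1)] R(3) by blast
    have "lin_eval \<eta> M (\<Sum>m\<in>Poly_Mapping.keys p. Poly_Mapping.single (?g m) (?c m)) = 0"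
      using p(2) by (simp add: lin_eval_sum_single cA lin_eval_def[of _ N] N_def)
    then have 0: "(\<Sum>m\<in>Poly_Mapping.keys p. Poly_Mapping.single (?g m) (?c m)) = 0"
      by (intro independent sum_polys single_polys cA)
    have "?c m = 0" for m
    proof (cases "m \<in> Poly_Mapping.keys p")
      case True
      then show ?thesis
        using lookup_sum_single_inj[OF finite_keys inj_on_subset[OF inj subset_UNIV] True, of ?c] 0
        by simp
    qed (simp add: in_keys_iff)
    then show ?thesis
      by (intro poly_mapping_eqI) simp
  qed
  let ?mul = "twisted_mult (\<lambda>_ _. 1 :: 'c) :: (nat ^ 'n \<Rightarrow>\<^sub>0 'c) \<Rightarrow> _"
  have mul: "?mul p p' \<in> polys_over R" "?F (?mul p p') = ?F p * ?F p'" "?E (?mul p p') = ?E p * ?E p'"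
    if "p \<in> polys_over R" "p' \<in> polys_over R" for p p'
    using that by (intro q.twisted_mult_polys q.lin_eval_twisted_mult c.lin_eval_twisted_mult;
        simp add: q.one_mem q.map_one c.map_one N_mult Y_mult)+
  have mul_commute: "?mul p p' = ?mul p' p" for p p'
    unfolding twisted_mult_def by (subst sum.swap) (simp add: add.commute mult.commute)
  define P where "P = (\<lambda>p. (?F p, ?E p)) ` polys_over R"
  have P_diff: "(u - u', v - v') \<in> P" if uv: "(u, v) \<in> P" "(u', v') \<in> P" for u v u' v'
  proof -
    from uv obtain p p' where "p \<in> polys_over R" "p' \<in> polys_over R"
      "u = ?F p" "v = ?E p" "u' = ?F p'" "v' = ?E p'"
      by (auto simp: P_def)
    then show ?thesis
      unfolding P_def
      by (intro image_eqI[of _ _ "p - p'"]) (simp_all add: q.lin_eval_diff c.lin_eval_diff q.diff_polys)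
  qed
  \<comment> \<open>Commutativity on the first components, inherited from that of polynomial
    multiplication, is what permits common denominators in the division ring.\<close>
  have P_mult: "(u * u', v * v') \<in> P" and P_commute: "u * u' = u' * u"
    if uv: "(u, v) \<in> P" "(u', v') \<in> P" for u v u' v'
  proof -
    from uv obtain p p' where p: "p \<in> polys_over R" "p' \<in> polys_over R"
      "u = ?F p" "v = ?E p" "u' = ?F p'" "v' = ?E p'"
      by (auto simp: P_def)
    show "(u * u', v * v') \<in> P"
      unfolding P_def by (intro image_eqI[of _ _ "?mul p p'"]) (simp_all add: p mul)
    show "u * u' = u' * u"
      using mul(2)[OF p(1,2)] mul(2)[OF p(2,1)] by (simp add: p mul_commute)
  qed
  have P_single: "(\<eta> a * N m, \<sigma> a * Y m) \<in> P" if "a \<in> R" for a m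
    unfolding P_def using that
    by (intro image_eqI[of _ _ "Poly_Mapping.single m a"])
      (simp_all add: q.lin_eval_single c.lin_eval_single q.single_polys)
  have P_zero_iff: "u = 0 \<longleftrightarrow> v = 0" if "(u, v) \<in> P" for u v
    using that F_0 E_0 q.lin_eval_zero c.lin_eval_zero by (auto simp: P_def)
  have P_one: "(1, 1) \<in> P"
    using P_single[OF q.one_mem, of 0] by (simp add: N_0 Y_0 q.map_one c.map_one)
  \<comment> \<open>Only \<open>z\<close> is required to be nonzero; \<open>P_zero_iff\<close> then
    gives the same for \<open>w\<close>.\<close>
  define G where "G = {(u * inverse w, v / z) | u v w z. (u, v) \<in> P \<and> (w, z) \<in> P \<and> z \<noteq> 0}"
  have GI: "(u * inverse w, v / z) \<in> G" if "(u, v) \<in> P" "(w, z) \<in> P" "z \<noteq> 0" for u v w z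
    using that by (auto simp: G_def)
  have GP: "(u, v) \<in> G" if "(u, v) \<in> P" for u v
    using GI[OF that P_one] by simp
  have "partial_iso G"
  proof
    show "(1, 1) \<in> G"
      by (rule GP[OF P_one])
  next
    fix u v u' v' assume "(u, v) \<in> G" "(u', v') \<in> G"
    then obtain a b c e a' b' c' e'
      where u: "u = a * inverse c" "v = b / e" "(a, b) \<in> P" "(c, e) \<in> P" "e \<noteq> 0"
        and u': "u' = a' * inverse c'" "v' = b' / e'" "(a', b') \<in> P" "(c', e') \<in> P" "e' \<noteq> 0"
      unfolding G_def by blast
    have c: "c \<noteq> 0" "c' \<noteq> 0"
      using u u' P_zero_iff by blast+
    have inv: "inverse (c * c') = inverse c' * inverse c" "inverse (c * c') = inverse c * inverse c'"
      using c nonzero_inverse_mult_distrib[of c c'] nonzero_inverse_mult_distrib[of c' c]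
        P_commute[OF u(4) u'(4)] by simp_all
    have den: "(c * c', e * e') \<in> P" "e * e' \<noteq> 0"
      using P_mult[OF u(4) u'(4)] u(5) u'(5) by auto
    have "u - u' = (a * c' - a' * c) * inverse (c * c')"
    proof -
      have "a * c' * inverse (c * c') = u"
        unfolding inv(1) u(1) using c by (simp add: mult.assoc) (simp flip: mult.assoc)
      moreover have "a' * c * inverse (c * c') = u'"
        unfolding inv(2) u'(1) using c by (simp add: mult.assoc) (simp flip: mult.assoc)
      ultimately show ?thesis
        by (simp add: left_diff_distrib)
    qed
    moreover have "v - v' = (b * e' - b' * e) / (e * e')"
      using u(5) u'(5) by (simp add: u(2) u'(2) field_simps)
    ultimately show "(u - u', v - v') \<in> G"
      using GI[OF P_diff[OF P_mult[OF u(3) u'(4)] P_mult[OF u'(3) u(4)]] den] by simp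
    have "inverse c * a' = a' * inverse c"
    proof -
      have "inverse c * a' = inverse c * (a' * c) * inverse c"
        using c by (simp add: mult.assoc)
      also have "a' * c = c * a'"
        by (rule P_commute[OF u'(3) u(4)])
      finally show ?thesis
        using c by (simp flip: mult.assoc)
    qed
    then have "u * u' = (a * a') * inverse (c * c')"
      unfolding inv(2) u(1) u'(1) by (metis mult.assoc)
    moreover have "v * v' = (b * b') / (e * e')"
      by (simp add: u(2) u'(2))
    ultimately show "(u * u', v * v') \<in> G"
      using GI[OF P_mult[OF u(3) u'(3)] den] by simp
  next
    fix u v assume "(u, v) \<in> G"
    then obtain a b c e
      where u: "u = a * inverse c" "v = b / e" "(a, b) \<in> P" "(c, e) \<in> P" "e \<noteq> 0"
      unfolding G_def by blast
    have c: "c \<noteq> 0" and ab: "a = 0 \<longleftrightarrow> b = 0"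
      using u P_zero_iff by blast+
    show "u = 0 \<longleftrightarrow> v = 0"
      using c u(5) by (simp add: u(1,2) ab)
    show "(inverse u, inverse v) \<in> G"
    proof (cases "b = 0")
      case True
      have "(0, 0) \<in> P"
        using P_diff[OF P_one P_one] by simp
      then show ?thesis
        using True ab GP by (simp add: u(1,2))
    next
      case False
      have "inverse u = c * inverse a" "inverse v = e / b"
        using False ab c by (simp_all add: u(1,2) nonzero_inverse_mult_distrib)
      then show ?thesis
        using GI[OF u(4,3) False] by simp
    qed
  qed
  moreover have "(\<eta> a, \<sigma> a) \<in> G" if "a \<in> R" for a
    using GP[OF P_single[OF that, of 0]] by (simp add: N_0 Y_0)
  moreover have "(M (axis i 1) ^ l, x i) \<in> G" for i
  proof -
    have "(\<chi> j. int (axis i (1::nat) $ j)) = axis i 1"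
      by (simp add: vec_eq_iff axis_def)
    then have "N (axis i 1) = M (axis i 1) ^ l"
      by (simp add: N_def M_power)
    moreover have "Y (axis i 1) = x i"
      by (simp add: Y_def axis_def if_distrib[of "\<lambda>n. _ ^ n"] cong: if_cong)
    ultimately show ?thesis
      using GP[OF P_single[OF q.one_mem, of "axis i 1"]] by (simp add: q.map_one c.map_one)
  qed
  ultimately show ?thesis
    by blast
qed

end

section \<open>Matching mutation sequences\<close>

context root_of_unity_algebra
begin

lemma algebra_isomorphic_upper:
  fixes M :: "int ^ 'n \<Rightarrow> 'd" and B :: "int ^ 'n ^ 'n::finite" and \<sigma> :: "'c \<Rightarrow> 'f::field"
    and x :: "'n \<Rightarrow> 'f"
  assumes seed: "quantum_seed A \<eta> l \<zeta> ex d M B" and coprime: "\<forall>j\<in>ex. coprime (int l) (d j)"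
    and R: "subring_algebra R \<eta>" "subring_algebra R \<sigma>" "R \<subseteq> A"
    and indep: "\<And>p. p \<in> polys_over R \<Longrightarrow> poly_eval \<sigma> x p = 0 \<Longrightarrow> p = 0"
  shows "algebra_isomorphic R \<eta> \<sigma> (central_upper R A \<eta> l \<zeta> ex iv M B)
    (upper_cluster_algebra R \<sigma> ex iv x B)"
proof -
  obtain \<Lambda> where "quantum_seed_map A \<eta> l \<zeta> \<Lambda> M ex d B"
    using quantum_seed_iff[OF coprime, THEN iffD1, OF seed] by (elim exE)
  then interpret M: quantum_seed_map A \<eta> l \<zeta> \<Lambda> M ex d B .
  have "\<exists>G. partial_iso G \<and> (\<forall>a\<in>R. (\<eta> a, \<sigma> a) \<in> G) \<and> (\<forall>i. (M (axis i 1) ^ l, x i) \<in> G)"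
    by (rule M.matching_exists[OF R indep])
  then obtain G where G: "partial_iso G" and GR: "\<And>a. a \<in> R \<Longrightarrow> (\<eta> a, \<sigma> a) \<in> G"
    and Gx: "\<And>i. (M (axis i 1) ^ l, x i) \<in> G"
    by (elim exE conjE) simp
  interpret G: partial_iso G by fact
  \<comment> \<open>\<open>d\<close> and \<open>G\<close> can stay fixed in this invariant: mutation
    preserves the symmetrizer, and \<open>G\<close> is closed under the exchange relation.\<close>
  define matched where "matched q c \<longleftrightarrow> snd q = snd c \<and>
      (\<exists>\<Lambda>. quantum_seed_map A \<eta> l \<zeta> \<Lambda> (fst q) ex d (snd q)) \<and> (\<forall>i. (fst q (axis i 1) ^ l, fst c i) \<in> G)"
    for q :: "(int ^ 'n \<Rightarrow> 'd) \<times> (int ^ 'n ^ 'n)" and c :: "('n \<Rightarrow> 'f) \<times> (int ^ 'n ^ 'n)"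
  have start: "matched (M, B) (x, B)"
    unfolding matched_def using M.quantum_seed_map_axioms Gx by auto
  have matched_step: "matched q' (mutate_seed k c)"
    if qc: "matched q c" and k: "k \<in> ex" and mut: "quantum_mutation A \<eta> l \<zeta> k q q'" for q c k q'
  proof -
    obtain M1 B1 x1 M2 B2 where q: "q = (M1, B1)" "c = (x1, B1)" "q' = (M2, B2)"
      using qc by (cases q; cases c; cases q') (auto simp: matched_def)
    obtain \<Lambda>1 where "quantum_seed_map A \<eta> l \<zeta> \<Lambda>1 M1 ex d B1" and x1: "\<And>i. (M1 (axis i 1) ^ l, x1 i) \<in> G"
      using qc by (auto simp: matched_def q)
    then interpret M1: quantum_seed_map A \<eta> l \<zeta> \<Lambda>1 M1 ex d B1 by simp
    interpret M1: quantum_mutation_step A \<eta> l \<zeta> \<Lambda>1 M1 ex d B1 k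
      by unfold_locales (rule k)
    obtain \<Lambda>2 where "quantum_seed_map A \<eta> l \<zeta> \<Lambda>2 M2 ex d B2" "B2 = mutate_matrix k B1"
      "\<And>i. M2 (axis i 1) = M1.new_frame (axis i 1)"
      using M1.quantum_mutation_cases mut unfolding q by metis
    then show ?thesis
      using M1.new_var_match[OF G x1] by (auto simp: matched_def q mutate_seed_def)
  qed
  \<comment> \<open>Quantum mutation is a relation, so a classical step can be followed only after a
    frame realising it has been produced.\<close>
  have exists_mutation: "\<exists>q'. quantum_mutation A \<eta> l \<zeta> k q q'" if qc: "matched q c" and k: "k \<in> ex" for q c k
  proof -
    obtain M1 B1 where q: "q = (M1, B1)"
      by (cases q)
    obtain \<Lambda>1 where "quantum_seed_map A \<eta> l \<zeta> \<Lambda>1 M1 ex d B1"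
      using qc by (auto simp: matched_def q)
    then interpret M1: quantum_seed_map A \<eta> l \<zeta> \<Lambda>1 M1 ex d B1 .
    interpret M1: quantum_mutation_step A \<eta> l \<zeta> \<Lambda>1 M1 ex d B1 k
      by unfold_locales (rule k)
    show ?thesis
      using M1.quantum_mutation_new_frame unfolding q by blast
  qed
  have forward: "\<exists>c. mutation_equivalent ex (x, B) c \<and> matched q c"
    if "quantum_mutation_equivalent A \<eta> l \<zeta> ex (M, B) q" for q
    using that unfolding quantum_mutation_equivalent_def
  proof (induction rule: rtranclp_induct)
    case base
    then show ?case using start by (auto simp: mutation_equivalent_def)
  next
    case (step q q')
    then obtain c k where c: "mutation_equivalent ex (x, B) c" "matched q c" "k \<in> ex"
      "quantum_mutation A \<eta> l \<zeta> k q q'"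
      by blast
    have "mutation_equivalent ex (x, B) (mutate_seed k c)"
      using c(1,3) unfolding mutation_equivalent_def by (blast intro: rtranclp.rtrancl_into_rtrancl)
    then show ?case
      using matched_step[OF c(2-4)]
      by blast
  qed
  have backward: "\<exists>q. quantum_mutation_equivalent A \<eta> l \<zeta> ex (M, B) q \<and> matched q c"
    if "mutation_equivalent ex (x, B) c" for c
    using that unfolding mutation_equivalent_def
  proof (induction rule: rtranclp_induct)
    case base
    then show ?case using start by (auto simp: quantum_mutation_equivalent_def)
  next
    case (step c c')
    then obtain q k where q: "quantum_mutation_equivalent A \<eta> l \<zeta> ex (M, B) q" "matched q c" "k \<in> ex"
      "c' = mutate_seed k c"
      by blast
    obtain q' where q': "quantum_mutation A \<eta> l \<zeta> k q q'"
      using exists_mutation[OF q(2,3)] by blast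
    have "quantum_mutation_equivalent A \<eta> l \<zeta> ex (M, B) q'"
      using q(1,3) q' unfolding quantum_mutation_equivalent_def by (blast intro: rtranclp.rtrancl_into_rtrancl)
    then show ?case
      using matched_step[OF q(2,3) q'] q(4)
      by blast
  qed
  define P where "P = {\<lambda>i. M'' (axis i 1) ^ l | M'' B''. quantum_mutation_equivalent A \<eta> l \<zeta> ex (M, B) (M'', B'')}"
  define Q where "Q = {x''. \<exists>B''. mutation_equivalent ex (x, B) (x'', B'')}"
  have "central_upper R A \<eta> l \<zeta> ex iv M B = (\<Inter>u\<in>P. mixed_torus (\<eta> ` R) u (ex \<union> iv))"
    unfolding central_upper_def P_def by blast
  moreover have "upper_cluster_algebra R \<sigma> ex iv x B = (\<Inter>u\<in>Q. mixed_torus (\<sigma> ` R) u (ex \<union> iv))"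
    unfolding upper_cluster_algebra_def Q_def by blast
  moreover have "algebra_isomorphic R \<eta> \<sigma> (\<Inter>u\<in>P. mixed_torus (\<eta> ` R) u (ex \<union> iv))
      (\<Inter>u\<in>Q. mixed_torus (\<sigma> ` R) u (ex \<union> iv))"
  proof (rule G.algebra_isomorphic_Inter[OF GR])
    show "\<exists>x\<in>Q. \<forall>i. (u i, x i) \<in> G" if "u \<in> P" for u
      using that forward by (fastforce simp: P_def Q_def matched_def)
    show "\<exists>u\<in>P. \<forall>i. (u i, x i) \<in> G" if "x \<in> Q" for x
      using that backward by (fastforce simp: P_def Q_def matched_def)
    show "P \<noteq> {}"
      unfolding P_def quantum_mutation_equivalent_def by blast
  qed
  ultimately show ?thesis
    by simp
qed

end

section \<open>The base rings\<close>

lemma algebra_over_mono: "algebra_over A \<eta> \<Longrightarrow> R \<subseteq> A \<Longrightarrow> algebra_over R \<eta>"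
  unfolding algebra_over_def by (meson subsetD)

lemma subset_fractions:
  assumes "1 \<in> R"
  shows "R \<subseteq> fractions R"
proof
  fix a assume "a \<in> R"
  then show "a \<in> fractions R"
    using assms unfolding fractions_def by (intro CollectI exI[of _ a] exI[of _ 1]) simp
qed

lemma seed_subring_algebra:
  assumes "seed R \<sigma> ex x B" "1 \<in> R" "\<And>a b. a \<in> R \<Longrightarrow> b \<in> R \<Longrightarrow> a - b \<in> R"
    "\<And>a b. a \<in> R \<Longrightarrow> b \<in> R \<Longrightarrow> a * b \<in> R"
  shows "subring_algebra R \<sigma>"
  using assms algebra_over_mono[OF _ subset_fractions]
  by (auto simp: subring_algebra_def seed_def generating_transcendence_basis_def)

lemma seed_independent:
  assumes "seed R \<sigma> ex x B" "1 \<in> R" "p \<in> polys_over R" "poly_eval \<sigma> x p = 0"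
  shows "p = 0"
  using assms polys_over_mono[OF subset_fractions]
  by (auto simp: seed_def generating_transcendence_basis_def)

lemma ground_ring_closed:
  shows "1 \<in> ground_ring"
    and "a \<in> ground_ring \<Longrightarrow> b \<in> ground_ring \<Longrightarrow> a - b \<in> ground_ring"
    and "a \<in> ground_ring \<Longrightarrow> b \<in> ground_ring \<Longrightarrow> a * b \<in> ground_ring"
proof -
  show "1 \<in> ground_ring"
    unfolding ground_ring_def by (rule range_eqI[of _ _ 1]) (simp flip: One_fract_def)
  assume "a \<in> ground_ring" "b \<in> ground_ring"
  then obtain r s where ab: "a = to_ac (Fraction_Field.Fract r 1)" "b = to_ac (Fraction_Field.Fract s 1)"
    by (auto simp: ground_ring_def)
  show "a - b \<in> ground_ring"
    unfolding ground_ring_def by (rule range_eqI[of _ _ "r - s"]) (simp add: ab flip: to_ac_diff)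
  show "a * b \<in> ground_ring"
    unfolding ground_ring_def by (rule range_eqI[of _ _ "r * s"]) (simp add: ab flip: to_ac_mult)
qed

lemma two_neq_zero: "(2 :: 'k::{idom,ring_char_0} fract alg_closure) \<noteq> 0"
proof -
  have "Fraction_Field.Fract (of_nat 2) 1 \<noteq> (0 :: 'k fract)"
    by (simp add: Zero_fract_def eq_fract)
  then have "to_ac (of_nat 2 :: 'k fract) \<noteq> 0"
    by (simp only: Fract_of_nat_eq to_ac_eq_0_iff not_False_eq_True)
  then show ?thesis
    by simp
qed

theorem proposition3p1:
  fixes \<zeta> :: "'k::{idom,ring_char_0} fract alg_closure"
    and l :: nat
    and ex iv :: "'n::finite set"
    and B :: "int ^ 'n ^ 'n"
    and d :: "'n \<Rightarrow> int"
    and \<eta> :: "'k fract alg_closure \<Rightarrow> 'd::division_ring"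
    and M :: "int ^ 'n \<Rightarrow> 'd"
    and \<sigma> :: "'k fract alg_closure \<Rightarrow> 'f::field"
    and x :: "'n \<Rightarrow> 'f"
    and \<tau> :: "'k fract alg_closure \<Rightarrow> 'g::field"
    and y :: "'n \<Rightarrow> 'g"
  assumes "ex \<inter> iv = {}"
    and "primitive_root_of_unity l \<zeta>"
    and "algebra_over (ground_ring_adjoin \<zeta>) \<eta>"
    and "quantum_seed (ground_ring_adjoin \<zeta>) \<eta> l \<zeta> ex d M B"
    and "odd l"
    and "\<forall>j\<in>ex. coprime (int l) (d j)"
    and "seed ground_ring \<sigma> ex x B"
    and "seed (ground_ring_adjoin \<zeta>) \<tau> ex y B"
  shows "algebra_isomorphic ground_ring \<eta> \<sigma>
           (central_upper ground_ring (ground_ring_adjoin \<zeta>) \<eta> l \<zeta> ex iv M B)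
           (upper_cluster_algebra ground_ring \<sigma> ex iv x B)
       \<and> algebra_isomorphic (ground_ring_adjoin \<zeta>) \<eta> \<tau>
           (central_upper (ground_ring_adjoin \<zeta>) (ground_ring_adjoin \<zeta>) \<eta> l \<zeta> ex iv M B)
           (upper_cluster_algebra (ground_ring_adjoin \<zeta>) \<tau> ex iv y B)"
proof
  let ?A = "ground_ring_adjoin \<zeta>"
  have A: "1 \<in> ?A" "\<And>a b. a \<in> ?A \<Longrightarrow> b \<in> ?A \<Longrightarrow> a - b \<in> ?A" "\<And>a b. a \<in> ?A \<Longrightarrow> b \<in> ?A \<Longrightarrow> a * b \<in> ?A"
    unfolding ground_ring_adjoin_def by (fact ring_adjoin.intros)+
  have sub: "ground_ring \<subseteq> ?A"
    unfolding ground_ring_adjoin_def by (blast intro: ring_adjoin.base)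
  have "\<zeta> \<in> ?A"
    unfolding ground_ring_adjoin_def by (blast intro: ring_adjoin.gen)
  then interpret root_of_unity_algebra ?A \<eta> l \<zeta>
    using assms A two_neq_zero by unfold_locales auto
  show "algebra_isomorphic ground_ring \<eta> \<sigma> (central_upper ground_ring ?A \<eta> l \<zeta> ex iv M B)
      (upper_cluster_algebra ground_ring \<sigma> ex iv x B)"
  proof (rule algebra_isomorphic_upper)
    show "subring_algebra ground_ring \<eta>"
      using algebra_over_mono[OF assms(3) sub] ground_ring_closed by unfold_locales
    show "subring_algebra ground_ring \<sigma>"
      by (rule seed_subring_algebra[OF assms(7)]) (fact ground_ring_closed)+
  qed (use assms sub seed_independent[OF assms(7) ground_ring_closed(1)] in auto)
  show "algebra_isomorphic ?A \<eta> \<tau> (central_upper ?A ?A \<eta> l \<zeta> ex iv M B) (upper_cluster_algebra ?A \<tau> ex iv y B)"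
  proof (rule algebra_isomorphic_upper)
    show "subring_algebra ?A \<eta>"
      by unfold_locales
    show "subring_algebra ?A \<tau>"
      by (rule seed_subring_algebra[OF assms(8)]) (fact A)+
  qed (use assms seed_independent[OF assms(8) A(1)] in auto)
qed

end
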